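(* Let $d\ge 2$ be an integer and let $c_d=\frac12-\frac1{10}d^{-2d-5}$. If $G$ is a graph of order $n$ with maximum degree $\Delta(G)=d$ that has no isolated vertex and no isolated edge, then $$\mathrm{D}_1(G)\le c_d\, n+d^2+d+\tfrac72 .$$ If $G$ is an arbitrary graph of order $n$ with $\Delta(G)=d$, then the same bound holds for $\bar{\mathrm{D}}_1(G)$, that is, $\bar{\mathrm{D}}_1(G)\le c_d\, n+d^2+d+\frac72$.
   Context: Graphs are finite, undirected and loopless; the order is the number of vertices. An isolated edge is a connected component consisting of two adjacent vertices. A graph is regarded as a structure with a single irreflexive symmetric binary predicate $E$ (adjacency). First order formulas use $E$, $=$ and the connectives $\neg,\wedge,\vee$. A closed formula $\Phi$ distinguishes $G$ from $G'$ if it is true on $G$ and false on $G'$. It defines $G$ if it distinguishes $G$ from every non-isomorphic (finite) structure with a single binary relation, of any order (equivalently for the parameters below, from every non-isomorphic graph of any order). It identifies $G$ if it distinguishes $G$ from every non-isomorphic graph of the same order as $G$. The set $\mathrm{Nest}(\Phi)$ of sequences of nested quantifiers is defined inductively: $\mathrm{Nest}(\Phi)=\{\epsilon\}$ (the empty word) for atomic $\Phi$; $\mathrm{Nest}(\neg\Phi)$ is obtained from $\mathrm{Nest}(\Phi)$ by exchanging $\exists$ and $\forall$ in all words; $\mathrm{Nest}(\Phi\wedge\Psi)=\mathrm{Nest}(\Phi\vee\Psi)=\mathrm{Nest}(\Phi)\cup\mathrm{Nest}(\Psi)$; $\mathrm{Nest}(\exists x\Phi)$ and $\mathrm{Nest}(\forall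 x\Phi)$ are obtained by prepending $\exists$, respectively $\forall$, to every word of $\mathrm{Nest}(\Phi)$. The quantifier rank of $\Phi$ is the maximum length of a word in $\mathrm{Nest}(\Phi)$; the alternation number of $\Phi$ is the maximum, over words in $\mathrm{Nest}(\Phi)$, of the number of occurrences of $\exists\forall$ and $\forall\exists$ as consecutive letters. $\mathrm{D}_1(G)$ (respectively $\bar{\mathrm{D}}_1(G)$) is the minimum quantifier rank of a formula with alternation number at most $1$ that defines (respectively identifies) $G$. *)

theory Defs
  imports
    "Graph_Theory.Graph_Theory"
    "HOL-Library.Extended_Real"
begin

text \<open>
  A finite structure with a single binary relation is a \<open>pair_fin_digraph\<close> (loops and
  asymmetry are allowed there); a graph is a \<open>pair_graph\<close>, i.e. such a structure whose
  relation is irreflexive and symmetric.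
\<close>

subsection \<open>First-order formulas\<close>

datatype formula =
    Adj nat nat
  | Equal nat nat
  | Neg formula
  | Conj formula formula
  | Disj formula formula
  | Exists nat formula
  | Forall nat formula

primrec free_vars :: "formula \<Rightarrow> nat set" where
  "free_vars (Adj x y) = {x, y}"
| "free_vars (Equal x y) = {x, y}"
| "free_vars (Neg \<Phi>) = free_vars \<Phi>"
| "free_vars (Conj \<Phi> \<Psi>) = free_vars \<Phi> \<union> free_vars \<Psi>"
| "free_vars (Disj \<Phi> \<Psi>) = free_vars \<Phi> \<union> free_vars \<Psi>"
| "free_vars (Exists x \<Phi>) = free_vars \<Phi> - {x}"
| "free_vars (Forall x \<Phi>) = free_vars \<Phi> - {x}"

definition closed_formula :: "formula \<Rightarrow> bool" where
  "closed_formula \<Phi> \<longleftrightarrow> free_vars \<Phi> = {}"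

primrec sat :: "'a pair_pre_digraph \<Rightarrow> (nat \<Rightarrow> 'a) \<Rightarrow> formula \<Rightarrow> bool" where
  "sat G e (Adj x y) \<longleftrightarrow> (e x, e y) \<in> parcs G"
| "sat G e (Equal x y) \<longleftrightarrow> e x = e y"
| "sat G e (Neg \<Phi>) \<longleftrightarrow> \<not> sat G e \<Phi>"
| "sat G e (Conj \<Phi> \<Psi>) \<longleftrightarrow> sat G e \<Phi> \<and> sat G e \<Psi>"
| "sat G e (Disj \<Phi> \<Psi>) \<longleftrightarrow> sat G e \<Phi> \<or> sat G e \<Psi>"
| "sat G e (Exists x \<Phi>) \<longleftrightarrow> (\<exists>v\<in>pverts G. sat G (e(x := v)) \<Phi>)"
| "sat G e (Forall x \<Phi>) \<longleftrightarrow> (\<forall>v\<in>pverts G. sat G (e(x := v)) \<Phi>)"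

text \<open>Truth of a closed formula; by \<open>holds_iff_sat\<close> below the assignment does not matter.\<close>

definition holds :: "'a pair_pre_digraph \<Rightarrow> formula \<Rightarrow> bool" where
  "holds G \<Phi> \<longleftrightarrow> (\<forall>e. sat G e \<Phi>)"

lemma sat_cong: "(\<And>x. x \<in> free_vars \<Phi> \<Longrightarrow> e x = e' x) \<Longrightarrow> sat G e \<Phi> \<longleftrightarrow> sat G e' \<Phi>"
proof (induction \<Phi> arbitrary: e e')
  case (Neg \<Phi>)
  have "sat G e \<Phi> \<longleftrightarrow> sat G e' \<Phi>"
    by (rule Neg.IH) (use Neg.prems in simp)
  then show ?case by simp
next
  case (Conj \<Phi> \<Psi>)
  then show ?case by (metis UnCI free_vars.simps(4) sat.simps(4))
next
  case (Disj \<Phi> \<Psi>)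
  then show ?case by (metis UnCI free_vars.simps(5) sat.simps(5))
next
  case (Exists x \<Phi>)
  have "sat G (e(x := v)) \<Phi> \<longleftrightarrow> sat G (e'(x := v)) \<Phi>" for v
    by (rule Exists.IH) (use Exists.prems in auto)
  then show ?case by simp
next
  case (Forall x \<Phi>)
  have "sat G (e(x := v)) \<Phi> \<longleftrightarrow> sat G (e'(x := v)) \<Phi>" for v
    by (rule Forall.IH) (use Forall.prems in auto)
  then show ?case by simp
qed simp_all

lemma holds_iff_sat: "closed_formula \<Phi> \<Longrightarrow> holds G \<Phi> \<longleftrightarrow> sat G e \<Phi>"
  unfolding holds_def closed_formula_def by (metis empty_iff sat_cong)

subsection \<open>Quantifier rank and alternation number\<close>

datatype quantifier = QExists | QForall

primrec dual :: "quantifier \<Rightarrow> quantifier" where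
  "dual QExists = QForall"
| "dual QForall = QExists"

primrec nest :: "formula \<Rightarrow> quantifier list set" where
  "nest (Adj x y) = {[]}"
| "nest (Equal x y) = {[]}"
| "nest (Neg \<Phi>) = map dual ` nest \<Phi>"
| "nest (Conj \<Phi> \<Psi>) = nest \<Phi> \<union> nest \<Psi>"
| "nest (Disj \<Phi> \<Psi>) = nest \<Phi> \<union> nest \<Psi>"
| "nest (Exists x \<Phi>) = (#) QExists ` nest \<Phi>"
| "nest (Forall x \<Phi>) = (#) QForall ` nest \<Phi>"

lemma finite_nest: "finite (nest \<Phi>)" and nest_nonempty: "nest \<Phi> \<noteq> {}"
  by (induction \<Phi>) auto

fun alternations :: "quantifier list \<Rightarrow> nat" where
  "alternations (p # q # w) = (if p \<noteq> q then 1 else 0) + alternations (q # w)"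
| "alternations _ = 0"

definition quantifier_rank :: "formula \<Rightarrow> nat" where
  "quantifier_rank \<Phi> = Max (length ` nest \<Phi>)"

definition alternation_number :: "formula \<Rightarrow> nat" where
  "alternation_number \<Phi> = Max (alternations ` nest \<Phi>)"

subsection \<open>Defining and identifying formulas\<close>

definition distinguishes :: "formula \<Rightarrow> 'a pair_pre_digraph \<Rightarrow> 'b pair_pre_digraph \<Rightarrow> bool" where
  "distinguishes \<Phi> G H \<longleftrightarrow> holds G \<Phi> \<and> \<not> holds H \<Phi>"

abbreviation isomorphic :: "'a pair_pre_digraph \<Rightarrow> 'b pair_pre_digraph \<Rightarrow> bool" where
  "isomorphic G H \<equiv> digraph_iso (with_proj G) (with_proj H)"

lemma isomorphic_iff:
  assumes "pair_wf_digraph G" "pair_wf_digraph H"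
  shows "isomorphic G H \<longleftrightarrow>
    (\<exists>f. bij_betw f (pverts G) (pverts H) \<and>
         (\<forall>u\<in>pverts G. \<forall>v\<in>pverts G. (u, v) \<in> parcs G \<longleftrightarrow> (f u, f v) \<in> parcs H))"
    (is "_ \<longleftrightarrow> (\<exists>f. ?iso f)")
proof
  assume "isomorphic G H"
  then obtain h where h: "pre_digraph.digraph_isomorphism (with_proj G) h"
    and H: "with_proj H = app_iso h (with_proj G)"
    unfolding digraph_iso_def by blast
  have V: "pverts H = iso_verts h ` pverts G" and A: "parcs H = iso_arcs h ` parcs G"
    and T: "iso_tail h = fst" and S: "iso_head h = snd"
    using arg_cong[OF H, of verts] arg_cong[OF H, of arcs]
      arg_cong[OF H, of tail] arg_cong[OF H, of head] by simp_all
  have inj: "inj_on (iso_verts h) (pverts G)"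
    and ends: "\<And>a. a \<in> parcs G \<Longrightarrow> iso_arcs h a = (iso_verts h (fst a), iso_verts h (snd a))"
    using h unfolding pre_digraph.digraph_isomorphism_def by (auto simp: T S prod_eq_iff)
  have "(u, v) \<in> parcs G \<longleftrightarrow> (iso_verts h u, iso_verts h v) \<in> parcs H"
    if uv: "u \<in> pverts G" "v \<in> pverts G" for u v
  proof
    assume "(u, v) \<in> parcs G"
    then show "(iso_verts h u, iso_verts h v) \<in> parcs H"
      using ends[of "(u, v)"] by (force simp: A)
  next
    assume "(iso_verts h u, iso_verts h v) \<in> parcs H"
    then obtain a where a: "a \<in> parcs G"
      "iso_verts h u = iso_verts h (fst a)" "iso_verts h v = iso_verts h (snd a)"
      using ends by (auto simp: A)
    then have "u = fst a" "v = snd a"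
      using inj_onD[OF inj] uv assms(1) unfolding pair_wf_digraph_def by blast+
    then show "(u, v) \<in> parcs G" using a by simp
  qed
  then show "\<exists>f. ?iso f" using inj V by (auto simp: bij_betw_def)
next
  assume "\<exists>f. ?iso f"
  then obtain f where f: "?iso f" ..
  let ?h = "\<lparr>iso_verts = f, iso_arcs = map_prod f f, iso_head = snd, iso_tail = fst\<rparr>"
  have inj: "inj_on f (pverts G)" and V: "pverts H = f ` pverts G"
    using f by (auto simp: bij_betw_def)
  have G: "\<And>u v. (u, v) \<in> parcs G \<Longrightarrow> u \<in> pverts G \<and> v \<in> pverts G"
    and H: "\<And>u v. (u, v) \<in> parcs H \<Longrightarrow> u \<in> pverts H \<and> v \<in> pverts H"
    using assms pair_wf_digraph.wellformed' by metis+
  have "parcs H \<subseteq> map_prod f f ` parcs G"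
  proof
    fix a assume a: "a \<in> parcs H"
    obtain x y where xy: "a = (x, y)" by (cases a)
    then obtain u v where "u \<in> pverts G" "v \<in> pverts G" "x = f u" "y = f v"
      using H a V by blast
    then show "a \<in> map_prod f f ` parcs G" using a xy f by force
  qed
  moreover have "map_prod f f ` parcs G \<subseteq> parcs H" using f G by auto
  ultimately have A: "parcs H = map_prod f f ` parcs G" by blast
  have "inj_on (map_prod f f) (parcs G)"
    using inj G by (auto simp: inj_on_def)
  then have "pre_digraph.digraph_isomorphism (with_proj G) ?h"
    using inj assms(1) by (simp add: pre_digraph.digraph_isomorphism_def wf_digraph_wp_iff)
  moreover have "with_proj H = app_iso ?h (with_proj G)"
    using V A by (simp add: app_iso_def with_proj_def)
  ultimately show "isomorphic G H" unfolding digraph_iso_def by blast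
qed

text \<open>
  Every finite structure has an isomorphic copy on natural numbers, so letting \<open>H\<close> range over
  \<open>nat pair_pre_digraph\<close> covers all finite structures of every order. The null structure is not excluded: conjoining
  \<open>\<exists>x. x = x\<close> rules it out without affecting positive rank or the alternation number.
\<close>

definition defines_graph :: "formula \<Rightarrow> 'a pair_pre_digraph \<Rightarrow> bool" where
  "defines_graph \<Phi> G \<longleftrightarrow>
     (\<forall>H :: nat pair_pre_digraph.
        pair_fin_digraph H \<and> \<not> isomorphic G H \<longrightarrow> distinguishes \<Phi> G H)"

definition identifies_graph :: "formula \<Rightarrow> 'a pair_pre_digraph \<Rightarrow> bool" where
  "identifies_graph \<Phi> G \<longleftrightarrow>
     (\<forall>H :: nat pair_pre_digraph.
        pair_graph H \<and> card (pverts H) = card (pverts G) \<and> \<not> isomorphic G H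
          \<longrightarrow> distinguishes \<Phi> G H)"

text \<open>
  The values are extended naturals, so that an infimum over no formula would be \<open>\<infinity>\<close>; over
  at least one formula the infimum is attained, i.e. a minimum.
\<close>

definition D1 :: "'a pair_pre_digraph \<Rightarrow> enat" where
  "D1 G = (INF \<Phi>\<in>{\<Phi>. closed_formula \<Phi> \<and> alternation_number \<Phi> \<le> 1 \<and> defines_graph \<Phi> G}.
             enat (quantifier_rank \<Phi>))"

definition D1_bar :: "'a pair_pre_digraph \<Rightarrow> enat" where
  "D1_bar G = (INF \<Phi>\<in>{\<Phi>. closed_formula \<Phi> \<and> alternation_number \<Phi> \<le> 1 \<and> identifies_graph \<Phi> G}.
                 enat (quantifier_rank \<Phi>))"

subsection \<open>Graph parameters\<close>

text \<open>In a symmetric loopless digraph the out-degree of a vertex is its number of neighbours.\<close>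

abbreviation degree :: "'a pair_pre_digraph \<Rightarrow> 'a \<Rightarrow> nat" where
  "degree G v \<equiv> out_degree (with_proj G) v"

text \<open>The inserted \<open>0\<close> only serves to make the maximum well defined for the null graph.\<close>

definition max_degree :: "'a pair_pre_digraph \<Rightarrow> nat" where
  "max_degree G = Max (insert 0 (degree G ` pverts G))"

definition has_isolated_vertex :: "'a pair_pre_digraph \<Rightarrow> bool" where
  "has_isolated_vertex G \<longleftrightarrow> (\<exists>v\<in>pverts G. degree G v = 0)"

text \<open>In a symmetric digraph the strongly connected components are the connected components.\<close>

definition has_isolated_edge :: "'a pair_pre_digraph \<Rightarrow> bool" where
  "has_isolated_edge G \<longleftrightarrow>
     (\<exists>u v. (u, v) \<in> parcs G \<and> {u, v} \<in> pre_digraph.sccs_verts (with_proj G))"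

definition bound_const :: "nat \<Rightarrow> real" where
  "bound_const d = 1/2 - 1/10 * real d powi (- 2 * int d - 5)"

end

theory Submission
  imports Defs
begin

text \<open>
  For \<open>X \<subseteq> V\<close> let \<open>\<Phi>\<^sub>X\<close> be the formula \<open>\<exists>X \<forall>y\<^sub>1 \<dots> y\<^sub>r\<close> saying that every \<open>r\<close>-tuple has a
  quantifier-free type over \<open>X\<close> that is realised in \<open>G\<close>. It holds in \<open>H\<close> iff \<open>X\<close> can be placed in
  \<open>H\<close> so that every set of \<open>r\<close> vertices of \<open>H\<close> embeds into \<open>G\<close> over \<open>X\<close>. Group the vertices
  outside \<open>X\<close> by their component and their trace \<open>N(v) \<inter> X\<close>. If the number of groups is maximal
  subject to exceeding \<open>|X|\<close> by a given amount, then each vertex that is not alone in its group is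
  adjacent to all or none of the other vertices of every group. Such an \<open>X\<close> turns local
  embeddability, with \<open>r = d\<^sup>2 + d + 3\<close>, into \<open>|H| \<le> |G|\<close>, with equality only for isomorphic graphs,
  up to components with at most two vertices. As there are at least as many groups as elements of
  \<open>X\<close>, this costs \<open>|X| \<le> n/2\<close>; the linear gain comes from distant induced paths on five vertices,
  in each of which two elements of \<open>X\<close> create three groups. Exchanging \<open>G\<close> and \<open>H\<close> (negated
  formulas also have alternation number at most one) gives isomorphism. Components of order at most
  two are excluded by a formula of rank three or, for equal orders, counted by further formulas \<open>\<Phi>\<^sub>X\<close>.
\<close>

section \<open>Vertex sets with few elements and many traces\<close>

text \<open>Homogeneity settles adjacency between two groups that both have several vertices, but
  leaves adjacency to a one-vertex group open. A vertex of \<open>H\<close> is therefore described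
  by its group together with the one-vertex groups that it is adjacent to. Whether \<open>H\<close>
  has too many vertices with one description is a local question only if few vertices of
  \<open>G\<close> compete for it. The degree bound supplies this: there are at most
  \<open>d\<close> candidates, or the group has at most two vertices. One vertex of \<open>H\<close>
  too many, a witness against every unsuitable candidate, and the paths that make groups
  recognisable amount to at most 9 or \<open>3 * d + 3\<close> vertices, and \<open>r\<close> is at
  least both. Components enter the groups because a component of small diameter may contain no
  vertex at distance four from a chosen one; its name alone then provides the gain. The price is
  that groups are not visible locally, and untraced groups are made sparse to compensate for this.
  The paths start at vertices pairwise at distance at least 10, so the base saves
  \<open>n / (2 * d ^ 10)\<close> against \<open>n / 2\<close>. This is at least the saving
  \<open>n / (10 * d ^ (2 * d + 5))\<close> of the theorem.\<close>

definition component :: "'a rel \<Rightarrow> 'a \<Rightarrow> 'a set" where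
  "component E v = E\<^sup>* `` {v}"

definition trace :: "'a rel \<Rightarrow> 'a set \<Rightarrow> 'a \<Rightarrow> 'a set" where
  "trace E X v = E `` {v} \<inter> X"

definition label :: "'a rel \<Rightarrow> 'a set \<Rightarrow> 'a \<Rightarrow> 'a set \<times> 'a set" where
  "label E X v = (component E v, trace E X v)"

text \<open>The vertex \<open>v'\<close> witnesses that \<open>v\<close> is not alone in its group.
  Excluding \<open>v\<close> itself among \<open>u\<close> and \<open>u'\<close> allows a group to
  be a clique.\<close>

definition homogeneous :: "'a set \<Rightarrow> 'a rel \<Rightarrow> 'a set \<Rightarrow> bool" where
  "homogeneous V E X \<longleftrightarrow>
     (\<forall>v\<in>V - X. \<forall>v'\<in>V - X. \<forall>u\<in>V - X. \<forall>u'\<in>V - X.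
        v' \<noteq> v \<and> label E X v' = label E X v \<and> u \<noteq> v \<and> u' \<noteq> v \<and> label E X u = label E X u' \<and> (v, u) \<in> E
          \<longrightarrow> (v, u') \<in> E)"

text \<open>A third member \<open>c\<close> is demanded: only a group with two vertices besides the
  one moved into the base can pay for that move.\<close>

definition sparse_untraced :: "'a set \<Rightarrow> 'a rel \<Rightarrow> 'a set \<Rightarrow> bool" where
  "sparse_untraced V E X \<longleftrightarrow>
     (\<forall>a\<in>V - X. \<forall>b\<in>V - X. \<forall>c\<in>V - X.
        a \<noteq> b \<and> b \<noteq> c \<and> a \<noteq> c \<and> trace E X a = {} \<and> label E X a = label E X b \<and> label E X b = label E X c
          \<longrightarrow> (a, b) \<notin> E)"

lemma homogeneousD:
  assumes "homogeneous V E X" "v \<in> V - X" "v' \<in> V - X" "u \<in> V - X" "u' \<in> V - X"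
    "v' \<noteq> v" "label E X v' = label E X v" "u \<noteq> v" "u' \<noteq> v" "label E X u = label E X u'" "(v, u) \<in> E"
  shows "(v, u') \<in> E"
  using assms unfolding homogeneous_def by metis

locale sym_graph =
  fixes V :: "'a set" and E :: "'a rel"
  assumes finite_V: "finite V" and E_subset: "E \<subseteq> V \<times> V"
    and E_sym: "(u, v) \<in> E \<Longrightarrow> (v, u) \<in> E" and E_irrefl: "(v, v) \<notin> E"
begin

lemma E_inV: "(u, v) \<in> E \<Longrightarrow> u \<in> V \<and> v \<in> V"
  using E_subset by auto

lemma rtrancl_sym: "(u, v) \<in> E\<^sup>* \<Longrightarrow> (v, u) \<in> E\<^sup>*"
  using E_sym by (metis symI symD sym_rtrancl)

lemma relpow_sym: "(u, v) \<in> E ^^ k \<Longrightarrow> (v, u) \<in> E ^^ k"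
proof (induction k arbitrary: v)
  case (Suc k)
  then obtain w where "(u, w) \<in> E ^^ k" "(w, v) \<in> E" by auto
  then show ?case using Suc.IH E_sym by (metis relpow_Suc_I2)
qed auto

lemma component_eq_iff: "component E u = component E v \<longleftrightarrow> (u, v) \<in> E\<^sup>*"
proof
  assume "component E u = component E v"
  moreover have "v \<in> component E v" by (simp add: component_def)
  ultimately show "(u, v) \<in> E\<^sup>*" by (simp add: component_def set_eq_iff)
next
  assume "(u, v) \<in> E\<^sup>*"
  then show "component E u = component E v"
    unfolding component_def by (auto dest: rtrancl_sym rtrancl_trans)
qed

lemma component_adj: "(u, v) \<in> E \<Longrightarrow> component E u = component E v"
  by (simp add: component_eq_iff r_into_rtrancl)

text \<open>Moving a vertex \<open>v\<close> that violates homogeneity into \<open>X\<close> loses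
  no label, since \<open>v'\<close> still carries that of \<open>v\<close>, and it separates
  \<open>u\<close> from \<open>u'\<close>. The number of labels rises by at least one, which pays
  for the larger \<open>X\<close> and contradicts maximality.\<close>

lemma homogeneous_if_maximal:
  assumes X: "X \<subseteq> V" and t: "card X + t \<le> card (label E X ` (V - X))"
    and max: "\<And>X'. X' \<subseteq> V \<Longrightarrow> card X' + t \<le> card (label E X' ` (V - X')) \<Longrightarrow>
      card (label E X' ` (V - X')) \<le> card (label E X ` (V - X))"
  shows "homogeneous V E X"
  unfolding homogeneous_def
proof (intro ballI impI, elim conjE, rule ccontr)
  fix v v' u u'
  assume v: "v \<in> V - X" and v': "v' \<in> V - X" and u: "u \<in> V - X" and u': "u' \<in> V - X"
    and "v' \<noteq> v" "label E X v' = label E X v" and "u \<noteq> v" "u' \<noteq> v"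
    and l: "label E X u = label E X u'" and "(v, u) \<in> E" and n: "(v, u') \<notin> E"
  let ?X = "insert v X"
  let ?r = "\<lambda>(c, T). (c, T \<inter> X)"
  have r: "?r (label E ?X w) = label E X w" for w
    by (auto simp: label_def trace_def)
  have fin: "finite (label E ?X ` (V - ?X))" using finite_V by simp
  have "V - X = insert v (V - ?X)" using v by blast
  moreover have "label E X v \<in> label E X ` (V - ?X)"
    using \<open>v' \<noteq> v\<close> \<open>label E X v' = label E X v\<close>[symmetric] v' by simp
  ultimately have "label E X ` (V - X) = label E X ` (V - ?X)"
    by (metis image_insert insert_absorb)
  also have "\<dots> = ?r ` label E ?X ` (V - ?X)"
    using r by (simp add: image_image)
  finally have im: "label E X ` (V - X) = ?r ` label E ?X ` (V - ?X)" .
  have ne: "label E ?X u \<noteq> label E ?X u'"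
    using \<open>(v, u) \<in> E\<close> n E_sym by (auto simp: label_def trace_def)
  have "\<not> inj_on ?r (label E ?X ` (V - ?X))"
  proof
    assume "inj_on ?r (label E ?X ` (V - ?X))"
    moreover have "label E ?X u \<in> label E ?X ` (V - ?X)" "label E ?X u' \<in> label E ?X ` (V - ?X)"
      using u u' \<open>u \<noteq> v\<close> \<open>u' \<noteq> v\<close> by blast+
    ultimately show False using ne r l by (metis (no_types, lifting) inj_onD)
  qed
  then have lt: "card (label E X ` (V - X)) < card (label E ?X ` (V - ?X))"
    using im fin by (metis card_image_le inj_on_iff_eq_card nat_less_le)
  have "card ?X = Suc (card X)" using v X finite_V by (simp add: finite_subset)
  then have "card ?X + t \<le> card (label E ?X ` (V - ?X))" using t lt by simp
  then show False using max[of ?X] v X lt by force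
qed

lemma exists_maximal_extension:
  assumes X0: "X0 \<subseteq> V" "card X0 + t \<le> card (label E X0 ` (V - X0))"
  obtains X where "X \<subseteq> V" "homogeneous V E X" "card X + t \<le> card (label E X ` (V - X))"
proof -
  let ?A = "{X. X \<subseteq> V \<and> card X + t \<le> card (label E X ` (V - X))}"
  have "finite ?A" using finite_V by simp
  moreover have "X0 \<in> ?A" using X0 by simp
  ultimately obtain X where X: "X \<in> ?A"
    "\<And>X'. X' \<in> ?A \<Longrightarrow> card (label E X' ` (V - X')) \<le> card (label E X ` (V - X))"
    using obtains_MAX[of ?A "\<lambda>X. card (label E X ` (V - X))"]
    by (metis (no_types, lifting) Max_ge empty_iff finite_imageI image_eqI)
  then have "homogeneous V E X"
    by (intro homogeneous_if_maximal[of X t]) auto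
  with X that show thesis by auto
qed

text \<open>An untraced class of size at least three that is not independent is a clique. Moving one
  of its vertices into \<open>X\<close> makes the rest of it traced and splits no class; the two further
  vertices of the class pay for the new element of \<open>X\<close>.\<close>

lemma exists_sparse_extension:
  assumes X: "X \<subseteq> V" "homogeneous V E X" "card X + t \<le> card (label E X ` (V - X))"
  obtains X1 where "X1 \<subseteq> V" "homogeneous V E X1" "sparse_untraced V E X1" "2 * card X1 + t \<le> card V"
proof -
  define cls where "cls l = {v \<in> V - X. label E X v = l}" for l
  define bad where "bad = {l. snd l = {} \<and> 3 \<le> card (cls l) \<and> (\<exists>a\<in>cls l. \<exists>b\<in>cls l. (a, b) \<in> E)}"
  define z where "z l = (SOME v. v \<in> cls l)" for l
  define X1 where "X1 = X \<union> z ` bad"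
  have fincls: "finite (cls l)" for l using finite_V by (simp add: cls_def)
  have z: "z l \<in> cls l" if "l \<in> bad" for l
    unfolding z_def using that by (auto simp: bad_def intro: someI)
  \<comment> \<open>Homogeneity spreads one edge \<open>(p, q)\<close> of the group: first to
    \<open>(p, b)\<close>, then from \<open>b\<close> to \<open>a\<close>.\<close>
  have clique: "(a, b) \<in> E" if l: "l \<in> bad" and a: "a \<in> cls l" and b: "b \<in> cls l" and "a \<noteq> b" for l a b
  proof -
    obtain p q where pq: "p \<in> cls l" "q \<in> cls l" "(p, q) \<in> E" using l by (auto simp: bad_def)
    have "p \<noteq> q" using pq E_irrefl by auto
    show ?thesis
    proof (cases "p = b")
      case True
      have "(p, a) \<in> E"
        by (rule homogeneousD[OF X(2), of p q q a]) (use pq a b \<open>a \<noteq> b\<close> \<open>p \<noteq> q\<close> True in \<open>auto simp: cls_def\<close>)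
      then show ?thesis using True E_sym by blast
    next
      case False
      have "(p, b) \<in> E"
        by (rule homogeneousD[OF X(2), of p q q b]) (use pq a b False \<open>p \<noteq> q\<close> in \<open>auto simp: cls_def\<close>)
      then have "(b, p) \<in> E" by (rule E_sym)
      have "(b, a) \<in> E"
        by (rule homogeneousD[OF X(2), of b p p a])
          (use pq a b False \<open>a \<noteq> b\<close> \<open>(b, p) \<in> E\<close> in \<open>auto simp: cls_def\<close>)
      then show ?thesis by (rule E_sym)
    qed
  qed
  have same: "label E X1 u = label E X1 u' \<longleftrightarrow> label E X u = label E X u'"
    if u: "u \<in> V - X1" "u' \<in> V - X1" for u u'
  proof
    assume "label E X1 u = label E X1 u'"
    then show "label E X u = label E X u'" by (auto simp: label_def trace_def X1_def)
  next
    assume eq: "label E X u = label E X u'"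
    \<comment> \<open>Since \<open>w\<close> has a companion in its group, it is adjacent to all or
      none of the remaining vertices of each group. Hence the new elements of the base refine no
      label.\<close>
    have "(v, w) \<in> E \<longleftrightarrow> (v', w) \<in> E"
      if l: "l \<in> bad" and w: "w = z l" and "v \<in> V - X1" "v' \<in> V - X1" "label E X v = label E X v'" for v v' w l
    proof -
      have wc: "w \<in> cls l" using z l w by simp
      have "\<exists>w'\<in>cls l. w' \<noteq> w"
      proof (rule ccontr)
        assume "\<not> ?thesis"
        then have "cls l \<subseteq> {w}" by auto
        then have "card (cls l) \<le> 1" using card_mono[of "{w}"] by simp
        then show False using l by (simp add: bad_def)
      qed
      then obtain w' where w': "w' \<in> cls l" "w' \<noteq> w" by blast
      have nw: "x \<noteq> w" if "x \<in> V - X1" for x using that l w by (auto simp: X1_def)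
      have "(w, v) \<in> E \<Longrightarrow> (w, v') \<in> E" 
        by (rule homogeneousD[OF X(2), of w w' v v'])
          (use that wc w' nw in \<open>auto simp: cls_def X1_def\<close>)
      moreover have "(w, v') \<in> E \<Longrightarrow> (w, v) \<in> E" 
        by (rule homogeneousD[OF X(2), of w w' v' v])
          (use that wc w' nw in \<open>auto simp: cls_def X1_def\<close>)
      ultimately show ?thesis using E_sym by blast
    qed
    from this[OF _ refl u eq] have "trace E (z ` bad) u = trace E (z ` bad) u'"
      by (auto simp: trace_def)
    then show "label E X1 u = label E X1 u'"
      using eq by (auto simp: label_def trace_def X1_def)
  qed
  have "homogeneous V E X1"
    unfolding homogeneous_def
  proof (intro ballI impI, elim conjE)
    fix v v' u u'
    assume a: "v \<in> V - X1" "v' \<in> V - X1" "u \<in> V - X1" "u' \<in> V - X1"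
      "v' \<noteq> v" "label E X1 v' = label E X1 v" "u \<noteq> v" "u' \<noteq> v" "label E X1 u = label E X1 u'" "(v, u) \<in> E"
    show "(v, u') \<in> E"
      by (rule homogeneousD[OF X(2), of v v' u u']) (use a same in \<open>auto simp: X1_def\<close>)
  qed
  moreover have "sparse_untraced V E X1"
    unfolding sparse_untraced_def
  proof (intro ballI impI notI, elim conjE)
    fix a b c
    assume abc: "a \<in> V - X1" "b \<in> V - X1" "c \<in> V - X1" "a \<noteq> b" "b \<noteq> c" "a \<noteq> c"
      and tr: "trace E X1 a = {}" and l: "label E X1 a = label E X1 b" "label E X1 b = label E X1 c"
      and "(a, b) \<in> E"
    let ?l = "label E X a"
    have sub: "{a, b, c} \<subseteq> cls ?l" using abc l same by (auto simp: cls_def X1_def)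
    have "card {a, b, c} \<le> card (cls ?l)" by (rule card_mono[OF fincls sub])
    then have "?l \<in> bad"
      using abc sub tr \<open>(a, b) \<in> E\<close> by (auto simp: bad_def label_def trace_def X1_def)
    then have "(a, z ?l) \<in> E"
      using clique[of ?l a "z ?l"] z sub abc(1) by (auto simp: X1_def)
    then show False using tr \<open>?l \<in> bad\<close> by (auto simp: trace_def X1_def)
  qed
  moreover have "2 * card X1 + t \<le> card V"
  proof -
    let ?L = "label E X ` (V - X)"
    have finL: "finite ?L" using finite_V by simp
    have badL: "bad \<subseteq> ?L"
    proof
      fix l assume "l \<in> bad"
      then obtain a where "a \<in> cls l" by (auto simp: bad_def)
      then show "l \<in> ?L" by (auto simp: cls_def)
    qed
    have finb: "finite bad" using badL finL finite_subset by blast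
    have "card (V - X) = (\<Sum>l\<in>?L. card (cls l))"
    proof -
      have "V - X = (\<Union>l\<in>?L. cls l)" by (auto simp: cls_def)
      then have "card (V - X) = card (\<Union>l\<in>?L. cls l)" by simp
      also have "\<dots> = (\<Sum>l\<in>?L. card (cls l))"
        by (rule card_UN_disjoint) (use finL fincls in \<open>auto simp: cls_def\<close>)
      finally show ?thesis .
    qed
    \<comment> \<open>One vertex per group and two further ones per bad group. The latter cancel the
      \<open>2 * card bad\<close> by which \<open>2 * card X1\<close> may exceed
      \<open>2 * card X\<close>.\<close>
    also have "\<dots> \<ge> (\<Sum>l\<in>?L. 1 + (if l \<in> bad then 2 else 0))"
    proof (rule sum_mono)
      fix l assume "l \<in> ?L"
      then have "cls l \<noteq> {}" by (auto simp: cls_def)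
      then have "1 \<le> card (cls l)" using fincls[of l] by (simp add: Suc_le_eq card_gt_0_iff)
      then show "1 + (if l \<in> bad then 2 else 0) \<le> card (cls l)" by (simp add: bad_def)
    qed
    also have "(\<Sum>l\<in>?L. 1 + (if l \<in> bad then 2 else (0::nat))) = card ?L + 2 * card bad"
    proof -
      have "?L \<inter> bad = bad" using badL by blast
      then show ?thesis using finL by (simp only: sum.distrib sum.If_cases) simp
    qed
    finally have "card ?L + 2 * card bad \<le> card (V - X)" .
    moreover have "card (V - X) = card V - card X" "card X \<le> card V"
      using X(1) finite_V by (auto simp: card_Diff_subset finite_subset card_mono)
    moreover have "card X1 \<le> card X + card bad"
      unfolding X1_def using card_Un_le[of X "z ` bad"] card_image_le[OF finb, of z] by linarith
    ultimately show ?thesis using X(3) by linarith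
  qed
  moreover have "X1 \<subseteq> V" using X(1) z by (auto simp: X1_def cls_def)
  ultimately show thesis using that by blast
qed

end

section \<open>Distances, packings and the linear gain\<close>

locale bounded_graph = sym_graph +
  fixes d :: nat
  assumes degree_le: "card (E `` {v}) \<le> d"
begin

lemma finite_E: "finite E"
  using finite_V E_subset finite_subset by blast

lemma relpow_Image_finite: "finite ((E ^^ k) `` {v})"
proof (cases k)
  case (Suc m)
  then have "(E ^^ k) `` {v} \<subseteq> V" using E_subset by auto
  then show ?thesis using finite_V finite_subset by blast
qed simp

lemma card_relpow_le: "card ((E ^^ k) `` {v}) \<le> d ^ k"
proof (induction k)
  case (Suc k)
  have "(E ^^ Suc k) `` {v} = (\<Union>u\<in>(E ^^ k) `` {v}. E `` {u})" by auto
  then have "card ((E ^^ Suc k) `` {v}) \<le> (\<Sum>u\<in>(E ^^ k) `` {v}. card (E `` {u}))"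
    using card_UN_le[OF relpow_Image_finite] by metis
  also have "\<dots> \<le> card ((E ^^ k) `` {v}) * d"
    using sum_bounded_above[of "(E ^^ k) `` {v}" "\<lambda>u. card (E `` {u})" d] degree_le by simp
  also have "\<dots> \<le> d ^ k * d" using Suc.IH by (rule mult_right_mono) simp
  finally show ?case by (simp add: mult.commute)
qed simp

definition at_distance :: "'a \<Rightarrow> nat \<Rightarrow> 'a \<Rightarrow> bool" where
  "at_distance p i w \<longleftrightarrow> (p, w) \<in> E ^^ i \<and> (\<forall>j<i. (p, w) \<notin> E ^^ j)"

lemma at_distance_0: "at_distance p 0 w \<longleftrightarrow> w = p"
  by (auto simp: at_distance_def)

lemma at_distance_unique: "at_distance p i w \<Longrightarrow> at_distance p j w \<Longrightarrow> i = j"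
  unfolding at_distance_def by (metis linorder_neqE_nat)

lemma at_distance_adj:
  assumes "at_distance p i u" "at_distance p j w" "(u, w) \<in> E"
  shows "j \<le> Suc i"
proof (rule ccontr)
  assume "\<not> j \<le> Suc i"
  moreover have "(p, w) \<in> E ^^ Suc i" using assms by (auto simp: at_distance_def)
  ultimately show False using assms(2) unfolding at_distance_def by (meson not_le)
qed

lemma at_distance_pred:
  assumes "at_distance p (Suc i) w"
  obtains u where "at_distance p i u" "(u, w) \<in> E"
proof -
  obtain u where u: "(p, u) \<in> E ^^ i" "(u, w) \<in> E" using assms by (auto simp: at_distance_def)
  have "(p, u) \<notin> E ^^ j" if "j < i" for j
  proof
    assume "(p, u) \<in> E ^^ j"
    then have "(p, w) \<in> E ^^ Suc j" using u by auto
    then show False using assms that unfolding at_distance_def by (meson Suc_less_eq)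
  qed
  then show thesis using u that by (auto simp: at_distance_def)
qed

text \<open>The distance of \<open>q\<close> is at least \<open>i\<close>, and stepping back from
  \<open>q\<close> along predecessors passes through every smaller distance.\<close>

lemma at_distance_exists:
  assumes "(p, q) \<in> E\<^sup>*" "\<And>k. k < i \<Longrightarrow> (p, q) \<notin> E ^^ k"
  obtains w where "at_distance p i w"
proof -
  obtain k where "(p, q) \<in> E ^^ k" using assms(1) rtrancl_imp_relpow by blast
  define D where "D = (LEAST k. (p, q) \<in> E ^^ k)"
  have D: "at_distance p D q"
    unfolding at_distance_def D_def
    using LeastI[of "\<lambda>k. (p, q) \<in> E ^^ k", OF \<open>(p, q) \<in> E ^^ k\<close>] not_less_Least by blast
  then have "i \<le> D" using assms(2) by (meson at_distance_def not_le_imp_less)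
  then have "\<exists>w. at_distance p i w"
    by (induction rule: inc_induct) (use D at_distance_pred in metis)+
  then show thesis using that by blast
qed

text \<open>For a maximal set of vertices pairwise at distance at least 10, the balls of radius 9
  cover \<open>V\<close>. Each has at most \<open>1 + d + ... + d ^ 9\<close> vertices, which is at
  most \<open>d ^ 10\<close> because \<open>2 \<le> d\<close>.\<close>

lemma exists_packing:
  assumes "2 \<le> d"
  obtains P where "P \<subseteq> V" "card V \<le> card P * d ^ 10"
    "\<And>p q k. p \<in> P \<Longrightarrow> q \<in> P \<Longrightarrow> k < 10 \<Longrightarrow> (p, q) \<in> E ^^ k \<Longrightarrow> p = q"
proof -
  let ?A = "{P. P \<subseteq> V \<and> (\<forall>p\<in>P. \<forall>q\<in>P. \<forall>k<10. (p, q) \<in> E ^^ k \<longrightarrow> p = q)}"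
  have "finite ?A" using finite_V by simp
  moreover have "{} \<in> ?A" by simp
  ultimately obtain P where P: "P \<in> ?A" and max: "\<And>Q. Q \<in> ?A \<Longrightarrow> P \<subseteq> Q \<Longrightarrow> P = Q"
    using finite_has_maximal2 by (metis (no_types, lifting))
  have finP: "finite P" using P finite_V finite_subset by blast
  have "V \<subseteq> (\<Union>p\<in>P. \<Union>k\<in>{..<10}. (E ^^ k) `` {p})"
  proof
    fix v assume v: "v \<in> V"
    show "v \<in> (\<Union>p\<in>P. \<Union>k\<in>{..<10}. (E ^^ k) `` {p})"
    proof (rule ccontr)
      assume "\<not> ?thesis"
      then have far: "(p, v) \<notin> E ^^ k" if "p \<in> P" "k < 10" for p k using that by auto
      then have "(v, p) \<notin> E ^^ k" if "p \<in> P" "k < 10" for p k using that relpow_sym by blast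
      with far have "insert v P \<in> ?A" using P v by auto
      then have "v \<in> P" using max by blast
      then show False using far[of v 0] by simp
    qed
  qed
  then have "card V \<le> card (\<Union>p\<in>P. \<Union>k\<in>{..<10}. (E ^^ k) `` {p})"
    by (intro card_mono) (use finP relpow_Image_finite in auto)
  also have "\<dots> \<le> (\<Sum>p\<in>P. card (\<Union>k\<in>{..<10}. (E ^^ k) `` {p}))"
    by (rule card_UN_le[OF finP])
  also have "\<dots> \<le> card P * d ^ 10"
  proof -
    have "card (\<Union>k\<in>{..<10}. (E ^^ k) `` {p}) \<le> d ^ 10" for p
    proof -
      have "card (\<Union>k\<in>{..<10}. (E ^^ k) `` {p}) \<le> (\<Sum>k\<in>{..<10}. card ((E ^^ k) `` {p}))"
        by (rule card_UN_le) simp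
      also have "\<dots> \<le> (\<Sum>k\<in>{..<10}. d ^ k)" by (rule sum_mono) (rule card_relpow_le)
      also have "\<dots> \<le> d ^ 10"
      proof -
        have "(\<Sum>k<m. d ^ k) \<le> d ^ m" for m
        proof (induction m)
          case (Suc m)
          have "d ^ m + d ^ m \<le> d * d ^ m" using mult_right_mono[OF assms, of "d ^ m"] by linarith
          then show ?case using Suc unfolding lessThan_Suc power_Suc by simp
        qed simp
        then show ?thesis .
      qed
      finally show ?thesis .
    qed
    then show ?thesis using sum_bounded_above[of P _ "d ^ 10"] by simp
  qed
  finally show thesis using that P by blast
qed

text \<open>An induced path \<open>p, a, b, c, e\<close> supports the gain: \<open>{a, c}\<close> has two elements but induces
  three distinct nonempty traces, on \<open>p\<close>, \<open>b\<close> and \<open>e\<close>. A vertex of the packing that starts no such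
  path is the only one in its component, which contributes a label of its own.\<close>

lemma exists_gain:
  assumes P: "P \<subseteq> V"
    and far: "\<And>p q k. p \<in> P \<Longrightarrow> q \<in> P \<Longrightarrow> k < 10 \<Longrightarrow> (p, q) \<in> E ^^ k \<Longrightarrow> p = q"
  obtains X where "X \<subseteq> V" "card X + card P \<le> card (label E X ` (V - X))"
proof -
  define L where "L = {p \<in> P. \<exists>w. at_distance p 4 w}"
  have finP: "finite P" using P finite_V finite_subset by blast
  have LP: "L \<subseteq> P" by (auto simp: L_def)
  then have finL: "finite L" using finP finite_subset by blast
  have "\<exists>a b c e. at_distance p 1 a \<and> at_distance p 2 b \<and> at_distance p 3 c \<and> at_distance p 4 e \<and>
      (p, a) \<in> E \<and> (a, b) \<in> E \<and> (b, c) \<in> E \<and> (c, e) \<in> E" if "p \<in> L" for p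
  proof -
    obtain e where e: "at_distance p 4 e" using \<open>p \<in> L\<close> by (auto simp: L_def)
    obtain c where c: "at_distance p 3 c" "(c, e) \<in> E" 
      using at_distance_pred[of p 3 e] e by (auto simp: eval_nat_numeral)
    obtain b where b: "at_distance p 2 b" "(b, c) \<in> E" 
      using at_distance_pred[of p 2 c] c by (auto simp: eval_nat_numeral)
    obtain a where a: "at_distance p 1 a" "(a, b) \<in> E" 
      using at_distance_pred[of p 1 b] b by (auto simp: eval_nat_numeral)
    have "(p, a) \<in> E" using a(1) by (simp add: at_distance_def)
    then show ?thesis using a b c e by blast
  qed
  then obtain a b c e where path: "\<And>p. p \<in> L \<Longrightarrow> at_distance p 1 (a p) \<and> at_distance p 2 (b p) \<and>
      at_distance p 3 (c p) \<and> at_distance p 4 (e p) \<and>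
      (p, a p) \<in> E \<and> (a p, b p) \<in> E \<and> (b p, c p) \<in> E \<and> (c p, e p) \<in> E"
    by metis
  have in_V: "w \<in> V" if "p \<in> P" "at_distance p i w" for p i w
    using that P E_subset by (cases i) (auto simp: at_distance_def)
  have same: "p = q" if "p \<in> P" "q \<in> P" "at_distance p i w" "at_distance q j w" "i + j < 10" for p q i j w
  proof -
    have "(p, q) \<in> E ^^ (i + j)" 
      using that relpow_sym[of q w j] unfolding at_distance_def relpow_add by blast
    then show ?thesis using far that by blast
  qed
  \<comment> \<open>Vertices of different paths are never adjacent to elements of each other's base,
    as \<open>4 + 1 + 3 < 10\<close>. So traces can be computed on each path alone.\<close>
  have same_adj: "p = q"
    if "p \<in> P" "q \<in> P" "at_distance p i w" "at_distance q j u" "(w, u) \<in> E" "Suc (i + j) < 10" for p q i j w u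
  proof -
    have "(p, u) \<in> E ^^ Suc i" using that unfolding at_distance_def by auto
    then have "(p, q) \<in> E ^^ (Suc i + j)" 
      using that relpow_sym[of q u j] unfolding at_distance_def relpow_add by blast
    then show ?thesis using far[of p q "Suc i + j"] that by simp
  qed
  define X where "X = a ` L \<union> c ` L"
  \<comment> \<open>The vertices whose labels will be distinct:
    \<open>card Q = card P + 2 * card L\<close> against \<open>card X \<le> 2 * card L\<close>, a
    difference of at least \<open>card P\<close>.\<close>
  define Q where "Q = P \<union> b ` L \<union> e ` L"
  have XV: "X \<subseteq> V" using in_V path LP unfolding X_def by blast
  have Q_cases: "\<exists>p\<in>P. at_distance p 0 q \<and> q = p \<or> p \<in> L \<and> (at_distance p 2 q \<and> q = b p \<or> at_distance p 4 q \<and> q = e p)"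
    if "q \<in> Q" for q
    using that path LP unfolding Q_def by (auto simp: at_distance_0)
  have X_at: "\<exists>p\<in>L. at_distance p 1 x \<and> x = a p \<or> at_distance p 3 x \<and> x = c p" if "x \<in> X" for x
    using that path unfolding X_def by blast
  have "q \<notin> X" if "q \<in> Q" for q
  proof
    assume "q \<in> X"
    then obtain p j where p: "p \<in> L" "at_distance p j q" "j = 1 \<or> j = 3" using X_at by blast
    obtain p' i where p': "p' \<in> P" "at_distance p' i q" "i = 0 \<or> i = 2 \<or> i = 4" using Q_cases[OF \<open>q \<in> Q\<close>] by blast
    have "p = p'" using same[of p p' j q i] p p' LP by auto
    then have "i = j" using at_distance_unique p(2) p'(2) by blast
    then show False using p(3) p'(3) by linarith
  qed
  moreover have "Q \<subseteq> V" using P LP in_V path unfolding Q_def by blast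
  ultimately have QV: "Q \<subseteq> V - X" by blast
  have tr: "trace E X q = {x \<in> {a p, c p}. p \<in> L \<and> (q, x) \<in> E}"
    if "p \<in> P" "at_distance p i q" "i \<le> 4" for p q i
  proof (intro equalityI subsetI)
    fix x assume "x \<in> trace E X q"
    then have x: "x \<in> X" "(q, x) \<in> E" by (auto simp: trace_def)
    then obtain p' j where p': "p' \<in> L" "at_distance p' j x" "j \<le> 3" "x \<in> {a p', c p'}"
      using X_at by fastforce
    have "p = p'" using same_adj[of p p' i q j x] that p' x LP by auto
    then show "x \<in> {x \<in> {a p, c p}. p \<in> L \<and> (q, x) \<in> E}" using p' x by blast
  next
    fix x assume "x \<in> {x \<in> {a p, c p}. p \<in> L \<and> (q, x) \<in> E}"
    then show "x \<in> trace E X q" by (auto simp: trace_def X_def)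
  qed
  have ac: "a p \<noteq> c p" if "p \<in> L" for p
    using path[OF that] at_distance_unique[of p 1 "a p" 3] by fastforce
  have tr_p: "trace E X p = {a p}" and tr_b: "trace E X (b p) = {a p, c p}"
    and tr_e: "trace E X (e p) = {c p}" if "p \<in> L" for p
  proof -
    note q = path[OF that]
    have p: "p \<in> P" using that LP by blast
    have "(p, c p) \<notin> E" using at_distance_adj[of p 0 p 3 "c p"] q by (auto simp: at_distance_0)
    then show "trace E X p = {a p}" using tr[of p 0 p] p that q by (auto simp: at_distance_0)
    show "trace E X (b p) = {a p, c p}" using tr[of p 2 "b p"] p that q E_sym[of "a p" "b p"] by auto
    have "(a p, e p) \<notin> E" using at_distance_adj[of p 1 "a p" 4 "e p"] q by auto
    then have "(e p, a p) \<notin> E" using E_sym by blast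
    then show "trace E X (e p) = {c p}" using tr[of p 4 "e p"] p that q E_sym[of "c p" "e p"] by auto
  qed
  have tr_0: "trace E X p = {}" if "p \<in> P - L" for p
    using tr[of p 0 p] that by (auto simp: at_distance_0)
  \<comment> \<open>Without a vertex at distance 4 from \<open>p\<close>, the component of
    \<open>p\<close> lies within distance 3, while other elements of \<open>P\<close> are at
    distance at least 10. So no other element of \<open>P\<close> is in that component.\<close>
  have long: "p = q" if pq: "p \<in> P - L" "q \<in> P" "component E p = component E q" for p q
  proof (rule ccontr)
    assume "p \<noteq> q"
    then have "(p, q) \<notin> E ^^ k" if "k < 4" for k using far[of p q k] that pq by auto
    then obtain w where "at_distance p 4 w"
      using at_distance_exists[of p q 4] pq(3) component_eq_iff by blast
    then show False using pq(1) by (auto simp: L_def)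
  qed
  have inj_a: "p = q" if "p \<in> L" "q \<in> L" "a p = a q" for p q
    using same[of p q 1 "a p" 1] path[of p] path[of q] that LP by auto
  have inj_c: "p = q" if "p \<in> L" "q \<in> L" "c p = c q" for p q
    using same[of p q 3 "c p" 3] path[of p] path[of q] that LP by auto
  have neq_ac: "a p \<noteq> c q" if "p \<in> L" "q \<in> L" for p q
    using same[of p q 1 "a p" 3] path[of p] path[of q] that LP ac by force
  have pairs: "{a p} \<noteq> {a q, c q}" "{c p} \<noteq> {a q, c q}" "{a p} \<noteq> {c q}"
    "{a p, c p} = {a q, c q} \<Longrightarrow> p = q" if "p \<in> L" "q \<in> L" for p q
    using inj_a[OF that] neq_ac[OF that] neq_ac[OF that(2,1)] ac[OF that(2)] by (auto simp: doubleton_eq_iff)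
  have kind: "(\<exists>p\<in>P - L. q = p) \<or> (\<exists>p\<in>L. q = p) \<or> (\<exists>p\<in>L. q = b p) \<or> (\<exists>p\<in>L. q = e p)"
    if "q \<in> Q" for q
    using Q_cases[OF that] by blast
  have only_p: "q = p" if "p \<in> L" "q \<in> Q" "trace E X q = {a p}" for p q
    using kind[OF \<open>q \<in> Q\<close>]
  proof (elim disjE bexE)
    fix p' assume "p' \<in> L" "q = p'"
    then show ?thesis using that tr_p inj_a by simp
  qed (use that tr_0 tr_b tr_e pairs in \<open>simp_all, metis+\<close>)
  have only_b: "q = b p" if "p \<in> L" "q \<in> Q" "trace E X q = {a p, c p}" for p q
    using kind[OF \<open>q \<in> Q\<close>]
  proof (elim disjE bexE)
    fix p' assume "p' \<in> L" "q = b p'"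
    then show ?thesis using that tr_b pairs(4)[of p p'] by simp
  qed (use that tr_0 tr_p tr_e pairs in \<open>simp_all, metis+\<close>)
  have only_e: "q = e p" if "p \<in> L" "q \<in> Q" "trace E X q = {c p}" for p q
    using kind[OF \<open>q \<in> Q\<close>]
  proof (elim disjE bexE)
    fix p' assume "p' \<in> L" "q = e p'"
    then show ?thesis using that tr_e inj_c[of p p'] by simp
  next
    fix p' assume "p' \<in> P - L" "q = p'"
    then show ?thesis using that tr_0 by simp
  next
    fix p' assume "p' \<in> L" "q = p'"
    then show ?thesis using that tr_p pairs(3)[of p' p] by metis
  next
    fix p' assume "p' \<in> L" "q = b p'"
    then show ?thesis using that tr_b pairs(2)[of p p'] by metis
  qed
  have inj: "inj_on (label E X) Q"
  proof (rule inj_onI)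
    fix q q' assume q: "q \<in> Q" "q' \<in> Q" and l: "label E X q = label E X q'"
    then have t: "trace E X q' = trace E X q" and cc: "component E q = component E q'"
      by (auto simp: label_def)
    from kind[OF q(1)] show "q = q'"
    proof (elim disjE bexE)
      fix p assume p: "p \<in> P - L" "q = p"
      then have "trace E X q' = {}" using t tr_0 by simp
      then have "q' \<in> P" using kind[OF q(2)] LP tr_b tr_e by auto
      then show ?thesis using long[of p q'] p cc by simp
    next
      fix p assume "p \<in> L" "q = p"
      then show ?thesis using only_p[of p q'] q(2) t tr_p by simp
    next
      fix p assume "p \<in> L" "q = b p"
      then show ?thesis using only_b[of p q'] q(2) t tr_b by simp
    next
      fix p assume "p \<in> L" "q = e p"
      then show ?thesis using only_e[of p q'] q(2) t tr_e by simp
    qed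
  qed
  have cards: "card Q = card P + 2 * card L"
  proof -
    have b: "card (b ` L) = card L"
      by (rule card_image, rule inj_onI) (metis tr_b pairs(4))
    have e: "card (e ` L) = card L"
      by (rule card_image, rule inj_onI) (metis tr_e inj_c singleton_inject)
    have bp: "b p \<noteq> q" if "p \<in> L" "q \<in> P" for p q
    proof (cases "q \<in> L")
      case True
      then show ?thesis using tr_b[OF that(1)] tr_p[OF True] pairs(1)[OF True that(1)] by metis
    next
      case False
      then show ?thesis using tr_b[OF that(1)] tr_0[of q] that by auto
    qed
    have ep: "e p \<noteq> q" if "p \<in> L" "q \<in> P" for p q
    proof (cases "q \<in> L")
      case True
      then show ?thesis using tr_e[OF that(1)] tr_p[OF True] pairs(3)[OF True that(1)] by metis
    next
      case False
      then show ?thesis using tr_e[OF that(1)] tr_0[of q] that by auto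
    qed
    have eb: "e p \<noteq> b q" if "p \<in> L" "q \<in> L" for p q
      using tr_e[OF that(1)] tr_b[OF that(2)] pairs(2)[OF that] by metis
    have "P \<inter> b ` L = {}" using bp by blast
    moreover have "(P \<union> b ` L) \<inter> e ` L = {}"
    proof (rule ccontr)
      assume "(P \<union> b ` L) \<inter> e ` L \<noteq> {}"
      then obtain p where "p \<in> L" "e p \<in> P \<union> b ` L" by auto
      then show False using ep[of p "e p"] eb[of p] by auto
    qed
    ultimately have "card (P \<union> b ` L \<union> e ` L) = card P + card (b ` L) + card (e ` L)"
      using finP finL by (simp add: card_Un_disjoint)
    then show ?thesis unfolding Q_def using b e by simp
  qed
  have "card X \<le> 2 * card L"
    unfolding X_def using card_Un_le[of "a ` L" "c ` L"] card_image_le[OF finL, of a] card_image_le[OF finL, of c]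
    by linarith
  moreover have "card (label E X ` Q) = card Q" by (rule card_image[OF inj])
  moreover have "card (label E X ` Q) \<le> card (label E X ` (V - X))"
    by (rule card_mono) (use finite_V QV in auto)
  ultimately have "card X + card P \<le> card (label E X ` (V - X))" using cards by linarith
  then show thesis using that XV by blast
qed

text \<open>The packing size serves as the surplus \<open>t\<close>. The last conclusion is
  \<open>card X \<le> (1/2 - 1/(2 * d ^ 10)) * card V\<close>, written without division.\<close>

lemma exists_small_base:
  assumes "2 \<le> d"
  obtains X where "X \<subseteq> V" "homogeneous V E X" "sparse_untraced V E X"
    "2 * card X * d ^ 10 + card V \<le> card V * d ^ 10"
proof -
  obtain P where P: "P \<subseteq> V" "card V \<le> card P * d ^ 10"
    "\<And>p q k. p \<in> P \<Longrightarrow> q \<in> P \<Longrightarrow> k < 10 \<Longrightarrow> (p, q) \<in> E ^^ k \<Longrightarrow> p = q"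
    by (rule exists_packing[OF assms]) blast
  obtain X0 where X0: "X0 \<subseteq> V" "card X0 + card P \<le> card (label E X0 ` (V - X0))"
    by (rule exists_gain[OF P(1,3)])
  obtain X1 where X1: "X1 \<subseteq> V" "homogeneous V E X1" "card X1 + card P \<le> card (label E X1 ` (V - X1))"
    by (rule exists_maximal_extension[OF X0])
  obtain X where X: "X \<subseteq> V" "homogeneous V E X" "sparse_untraced V E X" "2 * card X + card P \<le> card V"
    by (rule exists_sparse_extension[OF X1])
  have "2 * card X * d ^ 10 + card V \<le> (2 * card X + card P) * d ^ 10"
    using P(2) by (simp add: algebra_simps)
  also have "\<dots> \<le> card V * d ^ 10" using X(4) by (rule mult_right_mono) simp
  finally show thesis using that X by blast
qed

end

section \<open>Local embeddings over a vertex set\<close>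

text \<open>The vertices whose component has at least three vertices, in a form that needs only two
  further vertices as witnesses.\<close>

definition core :: "'a set \<Rightarrow> 'a rel \<Rightarrow> 'a set" where
  "core V E = {v \<in> V. \<exists>u w. (v, u) \<in> E \<and> w \<noteq> v \<and> w \<noteq> u \<and> ((v, w) \<in> E \<or> (u, w) \<in> E)}"

definition partial_embedding :: "'b rel \<Rightarrow> 'a set \<Rightarrow> 'a rel \<Rightarrow> ('b \<Rightarrow> 'a) \<Rightarrow> 'b set \<Rightarrow> bool" where
  "partial_embedding F V E \<phi> S \<longleftrightarrow>
     \<phi> ` S \<subseteq> V \<and> inj_on \<phi> S \<and> (\<forall>u\<in>S. \<forall>v\<in>S. (u, v) \<in> F \<longleftrightarrow> (\<phi> u, \<phi> v) \<in> E)"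

text \<open>The map \<open>\<phi>\<close> may change with \<open>S\<close>; only its values on the
  image of \<open>X\<close> under \<open>h\<close> are common to all \<open>S\<close>.\<close>

definition locally_embeds ::
    "nat \<Rightarrow> 'a set \<Rightarrow> 'a rel \<Rightarrow> 'a set \<Rightarrow> ('a \<Rightarrow> 'b) \<Rightarrow> 'b set \<Rightarrow> 'b rel \<Rightarrow> bool" where
  "locally_embeds r V E X h W F \<longleftrightarrow> h ` X \<subseteq> W \<and>
     (\<forall>S\<subseteq>W. card S \<le> r \<longrightarrow> (\<exists>\<phi>. partial_embedding F V E \<phi> (S \<union> h ` X) \<and> (\<forall>x\<in>X. \<phi> (h x) = x)))"

text \<open>The semantic side of the formulas of the overview: for every base of at most
  \<open>k\<close> vertices, the formula read off from the first graph is true in the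
  second.\<close>

definition simulates :: "nat \<Rightarrow> nat \<Rightarrow> 'a set \<Rightarrow> 'a rel \<Rightarrow> 'b set \<Rightarrow> 'b rel \<Rightarrow> bool" where
  "simulates k r V E W F \<longleftrightarrow> (\<forall>X\<subseteq>V. card X \<le> k \<longrightarrow> (\<exists>h. locally_embeds r V E X h W F))"

lemma partial_embedding_mono: "partial_embedding F V E \<phi> S \<Longrightarrow> T \<subseteq> S \<Longrightarrow> partial_embedding F V E \<phi> T"
  unfolding partial_embedding_def by (meson image_mono inj_on_subset subset_iff subset_trans)

lemma label_preserving_injection:
  assumes "finite A" "finite B"
    and le: "\<And>v. v \<in> A \<Longrightarrow> card {u \<in> A. f u = f v} \<le> card {w \<in> B. g w = f v}"
  obtains \<psi> where "inj_on \<psi> A" "\<psi> ` A \<subseteq> B" "\<And>v. v \<in> A \<Longrightarrow> g (\<psi> v) = f v"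
proof -
  have *: "\<exists>\<psi>. inj_on \<psi> {u \<in> A. f u = f v} \<and> \<psi> ` {u \<in> A. f u = f v} \<subseteq> {w \<in> B. g w = f v}" if "v \<in> A" for v
    using card_le_inj[of "{u \<in> A. f u = f v}" "{w \<in> B. g w = f v}"] le[OF that] assms(1,2) by auto
  have "\<exists>\<psi>. inj_on \<psi> {u \<in> A. f u = l} \<and> \<psi> ` {u \<in> A. f u = l} \<subseteq> {w \<in> B. g w = l}" if "l \<in> f ` A" for l
  proof -
    from that obtain v where "v \<in> A" "l = f v" by blast
    then show ?thesis using * by simp
  qed
  then obtain \<Psi> where "\<forall>l\<in>f ` A. inj_on (\<Psi> l) {u \<in> A. f u = l} \<and> \<Psi> l ` {u \<in> A. f u = l} \<subseteq> {w \<in> B. g w = l}"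
    using bchoice[of "f ` A" "\<lambda>l \<psi>. inj_on \<psi> {u \<in> A. f u = l} \<and> \<psi> ` {u \<in> A. f u = l} \<subseteq> {w \<in> B. g w = l}"]
    by blast
  then have \<Psi>: "inj_on (\<Psi> l) {u \<in> A. f u = l}" "\<Psi> l ` {u \<in> A. f u = l} \<subseteq> {w \<in> B. g w = l}"
    if "l \<in> f ` A" for l using that by blast+
  define \<psi> where "\<psi> v = \<Psi> (f v) v" for v
  have *: "\<psi> v \<in> B \<and> g (\<psi> v) = f v" if "v \<in> A" for v
    using \<Psi>(2)[of "f v"] that unfolding \<psi>_def by blast
  have "inj_on \<psi> A"
  proof (rule inj_onI)
    fix u v assume uv: "u \<in> A" "v \<in> A" "\<psi> u = \<psi> v"
    then have "f u = f v" using * by metis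
    then show "u = v" using \<Psi>(1)[of "f v"] uv unfolding \<psi>_def inj_on_def by auto
  qed
  then show thesis using that * by blast
qed

context sym_graph
begin

lemma core_subset: "core V E \<subseteq> V"
  by (auto simp: core_def)

lemma core_adj:
  assumes "u \<in> core V E" "(u, v) \<in> E"
  shows "v \<in> core V E"
proof -
  obtain x w where xw: "(u, x) \<in> E" "w \<noteq> u" "w \<noteq> x" "(u, w) \<in> E \<or> (x, w) \<in> E"
    using assms(1) by (auto simp: core_def)
  have "(v, u) \<in> E" "v \<in> V" "v \<noteq> u" using assms(2) E_sym E_inV E_irrefl by blast+
  have "x \<noteq> u" using xw E_irrefl by blast
  show ?thesis
  proof (cases "x = v")
    case True
    then show ?thesis using xw \<open>(v, u) \<in> E\<close> \<open>v \<in> V\<close> unfolding core_def by auto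
  next
    case False
    then show ?thesis using xw(1) \<open>(v, u) \<in> E\<close> \<open>v \<in> V\<close> \<open>x \<noteq> u\<close> unfolding core_def by auto
  qed
qed

lemma core_path:
  assumes "(a, b) \<in> E" "(b, c) \<in> E" "a \<noteq> c"
  shows "a \<in> core V E" "b \<in> core V E" "c \<in> core V E"
proof -
  have "a \<in> V" "c \<noteq> b" using assms E_inV E_irrefl by blast+
  then show "a \<in> core V E" using assms unfolding core_def
    by (intro CollectI conjI exI[of _ b] exI[of _ c]) auto
  then show "b \<in> core V E" using core_adj assms by blast
  then show "c \<in> core V E" using core_adj assms by blast
qed

end

section \<open>A base placed in a second graph: groups recognised locally\<close>

locale base_extension = G: bounded_graph V E d + H: sym_graph W F
  for V :: "'a set" and E d and W :: "'b set" and F +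
  fixes X :: "'a set" and h :: "'a \<Rightarrow> 'b" and r :: nat
  assumes two_le_d: "2 \<le> d" and X_core: "X \<subseteq> core V E"
    and homog: "homogeneous (core V E) E X" and sparse: "sparse_untraced (core V E) E X"
    and local_emb: "locally_embeds r V E X h W F" and r_ge: "d\<^sup>2 + d + 3 \<le> r"
begin

definition emb :: "('b \<Rightarrow> 'a) \<Rightarrow> 'b set \<Rightarrow> bool" where
  "emb \<phi> S \<longleftrightarrow> partial_embedding F V E \<phi> (S \<union> h ` X) \<and> (\<forall>x\<in>X. \<phi> (h x) = x)"

definition trace_H :: "'b \<Rightarrow> 'a set" where
  "trace_H u = {x \<in> X. (u, h x) \<in> F}"

definition D :: "'b set" where "D = core W F - h ` X"

definition C :: "'a set" where "C = core V E - X"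

definition K :: "'a set \<times> 'a set \<Rightarrow> 'a set" where
  "K l = {q \<in> C. label E X q = l}"

lemma r_bounds: "9 \<le> r" "3 * d + 3 \<le> r"
proof -
  have "2 * d \<le> d\<^sup>2" using mult_right_mono[OF two_le_d, of d] by (simp add: power2_eq_square)
  then show "3 * d + 3 \<le> r" using r_ge by linarith
  then show "9 \<le> r" using two_le_d by linarith
qed

lemma emb_exists:
  assumes "S \<subseteq> W" "card S \<le> r"
  obtains \<phi> where "emb \<phi> S"
  using local_emb assms unfolding locally_embeds_def emb_def by blast

lemma emb_mono: "emb \<phi> S \<Longrightarrow> T \<subseteq> S \<Longrightarrow> emb \<phi> T"
  unfolding emb_def by (meson partial_embedding_mono subset_refl sup.mono)

lemma emb_adj: "emb \<phi> S \<Longrightarrow> u \<in> S \<Longrightarrow> v \<in> S \<Longrightarrow> (\<phi> u, \<phi> v) \<in> E \<longleftrightarrow> (u, v) \<in> F"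
  unfolding emb_def partial_embedding_def by auto

lemma emb_inj: "emb \<phi> S \<Longrightarrow> u \<in> S \<Longrightarrow> v \<in> S \<Longrightarrow> \<phi> u = \<phi> v \<Longrightarrow> u = v"
  unfolding emb_def partial_embedding_def by (auto dest: inj_onD)

lemma emb_notin_X: "emb \<phi> S \<Longrightarrow> u \<in> S \<Longrightarrow> u \<notin> h ` X \<Longrightarrow> \<phi> u \<in> V - X"
  unfolding emb_def partial_embedding_def inj_on_def
  by (metis Diff_iff UnCI image_eqI image_subset_iff)

lemma emb_trace: "emb \<phi> S \<Longrightarrow> u \<in> S \<Longrightarrow> trace E X (\<phi> u) = trace_H u"
  unfolding emb_def partial_embedding_def trace_def trace_H_def
  by (auto; metis UnCI imageI)

lemma D_sub: "D \<subseteq> W" and C_sub: "C \<subseteq> V"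
  using H.core_subset G.core_subset by (auto simp: D_def C_def)

lemma finite_D: "finite D" and finite_C: "finite C" and finite_K: "finite (K l)"
  using D_sub C_sub H.finite_V G.finite_V unfolding K_def
  by (auto intro: finite_subset)

lemma trace_in_core: "trace E X v \<noteq> {} \<Longrightarrow> v \<in> core V E"
  using X_core G.core_adj G.E_sym unfolding trace_def by blast

lemma no_three:
  assumes "p \<in> C" "q \<in> C" "s \<in> C" "p \<noteq> q" "q \<noteq> s" "p \<noteq> s" "trace E X p = {}"
    "label E X p = label E X q" "label E X q = label E X s"
  shows "(p, q) \<notin> E"
  using sparse assms unfolding sparse_untraced_def C_def by blast

text \<open>The label of \<open>\<phi> u\<close> depends on a component, hence on more than the vertices near \<open>u\<close>. But a
  nonempty trace names the component, so \<open>u\<close> together with a path to a traced vertex fixes the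
  label for every embedding; by sparsity a path with at most two edges suffices.\<close>

lemma anchor_exists:
  assumes u: "u \<in> D"
  shows "\<exists>A l. u \<in> A \<and> A \<subseteq> W \<and> finite A \<and> card A \<le> 3 \<and> (\<forall>\<phi>. emb \<phi> A \<longrightarrow> \<phi> u \<in> K l) \<and>
      (trace_H u \<noteq> {} \<longrightarrow> A = {u}) \<and>
      (trace_H u = {} \<and> 3 \<le> card (K l) \<longrightarrow> (\<exists>v\<in>D. A = {u, v} \<and> (u, v) \<in> F \<and> trace_H v \<noteq> {}))"
proof -
  have uW: "u \<in> W" and uX: "u \<notin> h ` X" and uc: "u \<in> core W F" using u D_sub by (auto simp: D_def)
  have traced_C: "\<phi> w \<in> C" if "emb \<phi> A" "w \<in> A" "w \<notin> h ` X" "trace_H w \<noteq> {}" for \<phi> A w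
    using that emb_notin_X[OF that(1-3)] emb_trace[OF that(1,2)] trace_in_core by (auto simp: C_def)
  show ?thesis
  proof (cases "trace_H u = {}")
    case False
    then obtain x where x: "x \<in> X" "x \<in> trace_H u" by (auto simp: trace_H_def)
    have "\<phi> u \<in> K (component E x, trace_H u)" if "emb \<phi> {u}" for \<phi>
    proof -
      have "(\<phi> u, x) \<in> E" using x emb_trace[OF that, of u] by (auto simp: trace_def)
      then show ?thesis
        using traced_C[OF that] uX False emb_trace[OF that, of u] G.component_adj[of "\<phi> u" x]
        by (simp add: K_def label_def)
    qed
    then show ?thesis using False uW by (intro exI[of _ "{u}"]) auto
  next
    case True
    have nbr: "v \<in> D" if "(u, v) \<in> F" for v
      using that H.core_adj[OF uc that] True H.E_sym by (auto simp: D_def trace_H_def)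
    show ?thesis
    proof (cases "\<exists>v. (u, v) \<in> F \<and> trace_H v \<noteq> {}")
      case True2: True
      then obtain v where v: "(u, v) \<in> F" "trace_H v \<noteq> {}" by blast
      then obtain x where x: "x \<in> X" "x \<in> trace_H v" by (auto simp: trace_H_def)
      have vD: "v \<in> D" using nbr v by blast
      have vX: "v \<notin> h ` X" using vD by (simp add: D_def)
      have "\<phi> u \<in> K (component E x, {})" if e: "emb \<phi> {u, v}" for \<phi>
      proof -
        have vx: "(\<phi> v, x) \<in> E" using x emb_trace[OF e, of v] by (auto simp: trace_def)
        have a: "(\<phi> v, \<phi> u) \<in> E" using emb_adj[OF e] v H.E_sym by auto
        have "\<phi> v \<in> core V E" using traced_C[OF e _ vX v(2)] by (auto simp: C_def)
        then have "\<phi> u \<in> core V E" using a G.core_adj by blast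
        moreover have "\<phi> u \<notin> X" using emb_notin_X[OF e, of u] uX by auto
        moreover have "component E (\<phi> u) = component E x"
          using G.component_adj[OF vx] G.component_adj[OF a] by simp
        ultimately show ?thesis
          using emb_trace[OF e, of u] True by (simp add: K_def label_def C_def)
      qed
      then show ?thesis using uW vD D_sub v True 
        by (intro exI[of _ "{u, v}"] exI[of _ "(component E x, {})"]) (auto simp: card_insert_if)
    next
      case False
      obtain v w where vw: "(u, v) \<in> F" "w \<noteq> u" "w \<noteq> v" "(u, w) \<in> F \<or> (v, w) \<in> F"
        using uc by (auto simp: core_def)
      have tv: "trace_H v = {}" using False vw by blast
      have uv: "u \<noteq> v" using vw H.E_irrefl by blast
      have vD: "v \<in> D" using nbr vw by blast
      \<comment> \<open>Were \<open>w\<close> untraced, the images of \<open>u\<close>,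
        \<open>v\<close>, \<open>w\<close> would be three untraced vertices of one group with an
        edge between the first two, against sparsity.\<close>
      have w: "(v, w) \<in> F \<and> trace_H w \<noteq> {}"
      proof (rule ccontr)
        assume n: "\<not> ?thesis"
        then have tw: "trace_H w = {}" using False vw by blast
        have wW: "w \<in> W" using vw H.E_inV by blast
        have wX: "w \<notin> h ` X" using vw True tv by (auto simp: trace_H_def)
        obtain \<phi> where e: "emb \<phi> {u, v, w}"
          by (rule emb_exists[of "{u, v, w}"])
            (use uW vD D_sub wW r_bounds(1) in \<open>auto simp: card_insert_if\<close>)
        have adj: "(\<phi> u, \<phi> v) \<in> E" "(\<phi> u, \<phi> w) \<in> E \<or> (\<phi> v, \<phi> w) \<in> E"
          using emb_adj[OF e] vw by auto
        have ne: "\<phi> u \<noteq> \<phi> v" "\<phi> v \<noteq> \<phi> w" "\<phi> u \<noteq> \<phi> w"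
          using emb_inj[OF e, of u v] emb_inj[OF e, of v w] emb_inj[OF e, of u w] uv vw(2,3) by blast+
        have "\<phi> u \<in> core V E" using adj ne G.core_path G.E_sym by metis
        then have cores: "\<phi> u \<in> core V E" "\<phi> v \<in> core V E" "\<phi> w \<in> core V E"
          using adj G.core_adj by blast+
        have comps: "component E (\<phi> u) = component E (\<phi> v)" "component E (\<phi> v) = component E (\<phi> w)"
          using adj G.component_adj by metis+
        have "(\<phi> u, \<phi> v) \<notin> E"
          by (rule no_three[of _ _ "\<phi> w"])
            (use cores comps ne emb_notin_X[OF e] emb_trace[OF e] True tv tw uX vD wX in
              \<open>auto simp: C_def D_def label_def\<close>)
        then show False using adj by blast
      qed
      then obtain x where x: "x \<in> X" "x \<in> trace_H w" by (auto simp: trace_H_def)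
      have wX: "w \<notin> h ` X" using w H.E_sym tv by (auto simp: trace_H_def)
      have wW: "w \<in> W" using w H.E_inV by blast
      let ?A = "{u, v, w}" and ?l = "(component E x, {})"
      have in_K: "\<phi> u \<in> K ?l \<and> \<phi> v \<in> K ?l \<and> (\<phi> u, \<phi> v) \<in> E" if e: "emb \<phi> ?A" for \<phi>
      proof -
        have "(\<phi> w, x) \<in> E" using x emb_trace[OF e, of w] by (auto simp: trace_def)
        moreover have a: "(\<phi> w, \<phi> v) \<in> E" "(\<phi> v, \<phi> u) \<in> E" using emb_adj[OF e] vw w H.E_sym by auto
        moreover have "\<phi> w \<in> core V E" using traced_C[OF e _ wX] w by (auto simp: C_def)
        then have "\<phi> v \<in> core V E" "\<phi> u \<in> core V E" using a G.core_adj by blast+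
        moreover have "\<phi> u \<notin> X" "\<phi> v \<notin> X" using emb_notin_X[OF e] uX vD by (auto simp: D_def)
        moreover have "component E (\<phi> u) = component E x" "component E (\<phi> v) = component E x"
          using G.component_adj[OF \<open>(\<phi> w, x) \<in> E\<close>] G.component_adj[OF a(1)] G.component_adj[OF a(2)] by simp_all
        ultimately show ?thesis
          using emb_trace[OF e, of u] emb_trace[OF e, of v] True tv G.E_sym by (simp add: K_def label_def C_def)
      qed
      \<comment> \<open>A third member of the group besides the adjacent \<open>\<phi> u\<close> and
        \<open>\<phi> v\<close> contradicts sparsity. So anchors of three vertices arise only for
        groups of at most two.\<close>
      have "\<not> 3 \<le> card (K ?l)"
      proof
        assume c3: "3 \<le> card (K ?l)"
        obtain \<phi> where e: "emb \<phi> ?A"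
          by (rule emb_exists[of ?A])
            (use uW vD D_sub wW r_bounds(1) in \<open>auto simp: card_insert_if\<close>)
        have "\<not> K ?l \<subseteq> {\<phi> u, \<phi> v}"
        proof
          assume "K ?l \<subseteq> {\<phi> u, \<phi> v}"
          then have "card (K ?l) \<le> card {\<phi> u, \<phi> v}" by (intro card_mono) auto
          also have "\<dots> \<le> 2" by (simp add: card_insert_if)
          finally show False using c3 by simp
        qed
        then obtain s where s: "s \<in> K ?l" "s \<noteq> \<phi> u" "s \<noteq> \<phi> v" by blast
        have "\<phi> u \<noteq> \<phi> v" using in_K[OF e] G.E_irrefl by metis
        have "(\<phi> u, \<phi> v) \<notin> E"
          by (rule no_three[of _ _ s]) (use in_K[OF e] s \<open>\<phi> u \<noteq> \<phi> v\<close> in \<open>auto simp: K_def label_def\<close>)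
        then show False using in_K[OF e] by blast
      qed
      then show ?thesis using in_K uW vD D_sub wW True
        by (intro exI[of _ ?A] exI[of _ ?l]) (auto simp: card_insert_if)
    qed
  qed
qed

end

context base_extension
begin

lemma K_trace: "q \<in> K l \<Longrightarrow> trace E X q = snd l"
  by (auto simp: K_def label_def)

definition anchored :: "'b \<Rightarrow> 'b set \<Rightarrow> 'a set \<times> 'a set \<Rightarrow> bool" where
  "anchored u A l \<longleftrightarrow> u \<in> A \<and> A \<subseteq> W \<and> finite A \<and> card A \<le> 3 \<and> (\<forall>\<phi>. emb \<phi> A \<longrightarrow> \<phi> u \<in> K l) \<and>
      (trace_H u \<noteq> {} \<longrightarrow> A = {u}) \<and>
      (trace_H u = {} \<and> 3 \<le> card (K l) \<longrightarrow> (\<exists>v\<in>D. A = {u, v} \<and> (u, v) \<in> F \<and> trace_H v \<noteq> {}))"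

definition anchor :: "'b \<Rightarrow> 'b set" where
  "anchor u = (SOME A. \<exists>l. anchored u A l)"

text \<open>The group into which every embedding of \<open>anchor u\<close> puts \<open>u\<close>: a
  global datum of \<open>G\<close>, attached to a vertex of \<open>H\<close>.\<close>

definition label_H :: "'b \<Rightarrow> 'a set \<times> 'a set" where
  "label_H u = (SOME l. anchored u (anchor u) l)"

lemma anchored: "u \<in> D \<Longrightarrow> anchored u (anchor u) (label_H u)"
proof -
  assume "u \<in> D"
  then have "\<exists>A l. anchored u A l" unfolding anchored_def by (rule anchor_exists)
  then have "\<exists>l. anchored u (anchor u) l" unfolding anchor_def by (rule someI_ex)
  then show ?thesis unfolding label_H_def by (rule someI_ex)
qed

lemma anchor:
  assumes "u \<in> D"
  shows "u \<in> anchor u" "anchor u \<subseteq> W" "finite (anchor u)" "card (anchor u) \<le> 3"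
    "trace_H u \<noteq> {} \<Longrightarrow> anchor u = {u}"
    "trace_H u = {} \<Longrightarrow> 3 \<le> card (K (label_H u)) \<Longrightarrow>
      \<exists>v\<in>D. anchor u = {u, v} \<and> (u, v) \<in> F \<and> trace_H v \<noteq> {}"
  using anchored[OF assms] unfolding anchored_def by blast+

lemma emb_K:
  assumes "u \<in> D" "emb \<phi> S" "anchor u \<subseteq> S"
  shows "\<phi> u \<in> K (label_H u)"
  using anchored[OF assms(1)] emb_mono[OF assms(2,3)] unfolding anchored_def by blast

lemma label_H_trace:
  assumes "u \<in> D"
  shows "snd (label_H u) = trace_H u"
proof -
  obtain \<phi> where e: "emb \<phi> (anchor u)"
    using emb_exists[of "anchor u"] anchor[OF assms] r_bounds by auto
  have "label E X (\<phi> u) = label_H u" using emb_K[OF assms e] by (simp add: K_def)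
  then show ?thesis using emb_trace[OF e anchor(1)[OF assms]] by (metis label_def snd_conv)
qed

section \<open>Counting the vertices with a given description\<close>

definition Y :: "'b set" where
  "Y = {y \<in> D. card (K (label_H y)) = 1}"

text \<open>Adjacency to one-vertex groups is what homogeneity leaves open. Recording it by labels
  makes the sets computed in \<open>H\<close> and in \<open>G\<close> comparable.\<close>

definition nbr_labels_H :: "'b \<Rightarrow> ('a set \<times> 'a set) set" where
  "nbr_labels_H u = {label_H y |y. y \<in> Y \<and> (u, y) \<in> F}"

definition nbr_labels_G :: "'a \<Rightarrow> ('a set \<times> 'a set) set" where
  "nbr_labels_G q = {label_H y |y. y \<in> Y \<and> (\<exists>p\<in>K (label_H y). (q, p) \<in> E)}"

lemma two_anchors:
  assumes "u \<in> D" "v \<in> D"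
  obtains \<phi> where "emb \<phi> (anchor u \<union> anchor v)"
  using emb_exists[of "anchor u \<union> anchor v"] anchor(2,4)[OF assms(1)] anchor(2,4)[OF assms(2)]
    card_Un_le[of "anchor u" "anchor v"] r_bounds(1) by fastforce

text \<open>Two anchors have at most six vertices, so one embedding covers both; it would send both
  vertices to the only element of the group.\<close>

lemma Y_inj:
  assumes "y \<in> Y" "y' \<in> D" "label_H y = label_H y'"
  shows "y = y'"
proof -
  have y: "y \<in> D" and c: "card (K (label_H y)) = 1" using assms(1) by (auto simp: Y_def)
  obtain \<phi> where e: "emb \<phi> (anchor y \<union> anchor y')" using two_anchors[OF y assms(2)] .
  have "\<phi> y \<in> K (label_H y)" "\<phi> y' \<in> K (label_H y)"
    using emb_K[OF y e] emb_K[OF assms(2) e] assms(3) by auto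
  then have "\<phi> y = \<phi> y'" using c by (metis card_1_singletonE singletonD)
  then show ?thesis using emb_inj[OF e] anchor(1)[OF y] anchor(1)[OF assms(2)] by blast
qed

lemma nbr_labels_H_iff: "y \<in> Y \<Longrightarrow> label_H y \<in> nbr_labels_H u \<longleftrightarrow> (u, y) \<in> F"
  using Y_inj unfolding nbr_labels_H_def Y_def by fastforce

lemma nbr_labels_G_iff: "y \<in> Y \<Longrightarrow> p \<in> K (label_H y) \<Longrightarrow> label_H y \<in> nbr_labels_G q \<longleftrightarrow> (q, p) \<in> E"
  unfolding nbr_labels_G_def Y_def by (auto simp: card_1_singleton_iff)

text \<open>If an embedding moves a vertex of the fibre over \<open>(l, B)\<close> to \<open>q\<close> with \<open>nbr_labels_G q \<noteq> B\<close>,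
  then a vertex of \<open>Y\<close> whose label lies in the symmetric difference detects it. One such witness
  for each \<open>q \<in> M\<close> outside the fibre of \<open>G\<close> therefore forces the fibre of \<open>H\<close> into that of \<open>G\<close>.\<close>

lemma fiber_card_le:
  assumes M: "M \<subseteq> K l"
    and Z: "Z \<subseteq> W"
    and into: "\<And>\<phi> S u. u \<in> D \<Longrightarrow> label_H u = l \<Longrightarrow> nbr_labels_H u = B \<Longrightarrow> emb \<phi> S \<Longrightarrow> Z \<union> anchor u \<subseteq> S \<Longrightarrow> \<phi> u \<in> M"
    and a: "\<And>u. u \<in> D \<Longrightarrow> label_H u = l \<Longrightarrow> nbr_labels_H u = B \<Longrightarrow> card (anchor u) \<le> a"
    and budget: "\<And>f. f \<le> card M \<Longrightarrow> card Z + (f + 1) * a + 3 * (card M - f) \<le> r"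
  shows "card {u \<in> D. label_H u = l \<and> nbr_labels_H u = B} \<le> card {q \<in> C. label E X q = l \<and> nbr_labels_G q = B}"
proof -
  let ?FH = "{u \<in> D. label_H u = l \<and> nbr_labels_H u = B}"
  let ?FG = "{q \<in> C. label E X q = l \<and> nbr_labels_G q = B}"
  have finM: "finite M" using M finite_K finite_subset by blast
  have finFG: "finite ?FG" using finite_C by simp
  let ?N = "M \<inter> ?FG"
  have "card ?FH \<le> card ?N"
  proof (rule ccontr)
    assume "\<not> ?thesis"
    then have "card ?N + 1 \<le> card ?FH" by simp
    \<comment> \<open>One vertex more than \<open>?N\<close> can hold. With
      \<open>f = card ?N\<close> this gives the factor \<open>f + 1\<close> of the budget; each of
      the other \<open>card M - f\<close> candidates costs a witness with an anchor of at most three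
      vertices.\<close>
    then obtain S0 where S0: "S0 \<subseteq> ?FH" "card S0 = card ?N + 1" "finite S0"
      by (rule obtain_subset_with_card_n)
    have witness: "\<exists>y. y \<in> Y \<and> (label_H y \<in> nbr_labels_G q \<longleftrightarrow> label_H y \<notin> B)" if q: "q \<in> M - ?FG" for q
    proof -
      have "S0 \<noteq> {}" using S0(2) by auto
      then obtain u where u: "u \<in> ?FH" using S0(1) by blast
      have "nbr_labels_G q \<noteq> B" using q M by (auto simp: K_def)
      moreover have "B \<subseteq> label_H ` Y" "nbr_labels_G q \<subseteq> label_H ` Y"
        using u by (auto simp: nbr_labels_H_def nbr_labels_G_def)
      ultimately show ?thesis by blast
    qed
    define y where "y q = (SOME y. y \<in> Y \<and> (label_H y \<in> nbr_labels_G q \<longleftrightarrow> label_H y \<notin> B))" for q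
    have y: "y q \<in> Y \<and> (label_H (y q) \<in> nbr_labels_G q \<longleftrightarrow> label_H (y q) \<notin> B)" if "q \<in> M - ?FG" for q
      unfolding y_def by (rule someI_ex[OF witness[OF that]])
    then have yD: "\<And>q. q \<in> M - ?FG \<Longrightarrow> y q \<in> D" by (auto simp: Y_def)
    let ?S = "Z \<union> (\<Union>u\<in>S0. anchor u) \<union> (\<Union>q\<in>M - ?FG. anchor (y q))"
    have "card ?S \<le> card Z + card (\<Union>u\<in>S0. anchor u) + card (\<Union>q\<in>M - ?FG. anchor (y q))"
      by (meson add_le_mono1 card_Un_le le_trans)
    also have "card (\<Union>u\<in>S0. anchor u) \<le> (\<Sum>u\<in>S0. card (anchor u))"
      by (rule card_UN_le[OF S0(3)])
    also have "\<dots> \<le> card S0 * a" using sum_bounded_above[of S0 "\<lambda>u. card (anchor u)" a] a S0(1) by auto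
    also have "card (\<Union>q\<in>M - ?FG. anchor (y q)) \<le> (\<Sum>q\<in>M - ?FG. card (anchor (y q)))"
      by (rule card_UN_le) (use finM in simp)
    also have "\<dots> \<le> card (M - ?FG) * 3"
      using sum_bounded_above[of "M - ?FG" "\<lambda>q. card (anchor (y q))" 3] anchor(4)[OF yD] by auto
    also have "card (M - ?FG) = card M - card ?N"
      using finM by (simp add: card_Diff_subset_Int)
    also have "card Z + card S0 * a + (card M - card ?N) * 3 \<le> r"
      using budget[of "card ?N"] card_mono[OF finM, of ?N] S0(2) by (simp add: mult.commute)
    finally have "card ?S \<le> r" by simp
    moreover have "?S \<subseteq> W" using Z S0(1) anchor(2) anchor(2)[OF yD] by blast
    ultimately obtain \<phi> where e: "emb \<phi> ?S" using emb_exists by blast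
    have "\<phi> u \<in> ?N" if "u \<in> S0" for u
    proof -
      have u: "u \<in> D" "label_H u = l" "nbr_labels_H u = B" using that S0(1) by auto
      have "\<phi> u \<in> M" by (rule into[OF u e]) (use that in blast)
      moreover have "\<phi> u \<in> ?FG"
      proof (rule ccontr)
        assume "\<phi> u \<notin> ?FG"
        then have q: "\<phi> u \<in> M - ?FG" using \<open>\<phi> u \<in> M\<close> by blast
        let ?y = "y (\<phi> u)"
        have yS: "anchor ?y \<subseteq> ?S" using q by blast
        have "label_H ?y \<in> nbr_labels_G (\<phi> u) \<longleftrightarrow> (\<phi> u, \<phi> ?y) \<in> E"
          using nbr_labels_G_iff y[OF q] emb_K[OF yD[OF q] e yS] by blast
        also have "\<dots> \<longleftrightarrow> (u, ?y) \<in> F"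
          by (rule emb_adj[OF e]) (use anchor(1)[OF u(1)] anchor(1)[OF yD[OF q]] that q yS in blast)+
        also have "\<dots> \<longleftrightarrow> label_H ?y \<in> B"
          using nbr_labels_H_iff[of ?y u] y[OF q] u(3) by simp
        finally show False using y[OF q] by blast
      qed
      ultimately show ?thesis by blast
    qed
    then have into_N: "\<phi> ` S0 \<subseteq> ?N" by blast
    have "inj_on \<phi> S0"
    proof (rule inj_onI)
      fix u v assume uv: "u \<in> S0" "v \<in> S0" "\<phi> u = \<phi> v"
      then have "u \<in> anchor u" "v \<in> anchor v" using S0(1) anchor(1) by auto
      then have "u \<in> ?S" "v \<in> ?S" using uv by blast+
      then show "u = v" using emb_inj[OF e] uv(3) by blast
    qed
    then have "card S0 \<le> card ?N" by (rule card_inj_on_le[OF _ into_N]) (use finM in simp)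
    then show False using S0(2) by simp
  qed
  also have "\<dots> \<le> card ?FG" by (rule card_mono[OF finFG]) blast
  finally show ?thesis .
qed

text \<open>The candidate set \<open>M\<close> must be small. A traced group lies in the
  neighbourhood of an element of its trace, hence has at most \<open>d\<close> vertices. A large
  untraced group has an anchor containing a traced neighbour \<open>v0\<close>; the neighbourhood of
  its image \<open>w\<close> then plays the same role, in a way that depends on whether
  \<open>v0\<close> belongs to a one-vertex group.\<close>

lemma fiber_card_le_label:
  assumes u0: "u0 \<in> D"
  shows "card {u \<in> D. label_H u = label_H u0 \<and> nbr_labels_H u = nbr_labels_H u0}
    \<le> card {q \<in> C. label E X q = label_H u0 \<and> nbr_labels_G q = nbr_labels_H u0}"
proof -
  let ?l = "label_H u0" and ?B = "nbr_labels_H u0"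
  have in_K: "\<phi> u \<in> K ?l" if "u \<in> D" "label_H u = ?l" "emb \<phi> S" "{} \<union> anchor u \<subseteq> S" for \<phi> S u
    using emb_K[OF that(1,3)] that(2,4) by simp
  consider (traced) "trace_H u0 \<noteq> {}" | (small) "card (K ?l) \<le> 2"
    | (large) "trace_H u0 = {}" "3 \<le> card (K ?l)" by linarith
  then show ?thesis
  proof cases
    case traced
    then obtain x where x: "x \<in> trace_H u0" by blast
    have "trace E X q = trace_H u0" if "q \<in> K ?l" for q
      using K_trace[OF that] label_H_trace[OF u0] by simp
    then have "K ?l \<subseteq> E `` {x}"
      using x G.E_sym unfolding trace_def by blast
    then have cK: "card (K ?l) \<le> d" using G.degree_le[of x] G.finite_E
      by (meson card_mono finite_Image le_trans)
    show ?thesis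
    proof (rule fiber_card_le[of "K ?l" ?l "{}" ?B 1])
      fix u assume "u \<in> D" "label_H u = ?l"
      then have "trace_H u \<noteq> {}" using traced label_H_trace u0 by metis
      then show "card (anchor u) \<le> 1" using anchor(5)[OF \<open>u \<in> D\<close>] by simp
    next
      fix f assume "f \<le> card (K ?l)"
      then show "card {} + (f + 1) * 1 + 3 * (card (K ?l) - f) \<le> r" using cK r_bounds(2) by simp
    qed (use in_K in auto)
  next
    case small
    show ?thesis
    proof (rule fiber_card_le[of "K ?l" ?l "{}" ?B 3])
      fix f assume "f \<le> card (K ?l)"
      then show "card {} + (f + 1) * 3 + 3 * (card (K ?l) - f) \<le> r" using small r_bounds(1) by simp
    qed (use in_K anchor(4) in auto)
  next
    case large
    obtain v0 where v0: "v0 \<in> D" "anchor u0 = {u0, v0}" "(u0, v0) \<in> F" "trace_H v0 \<noteq> {}"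
      using anchor(6)[OF u0 large] by blast
    have v0W: "v0 \<in> W" using v0(1) D_sub by blast
    have two: "card (anchor u) \<le> 2" if u: "u \<in> D" "label_H u = ?l" for u
    proof -
      have "trace_H u = {}" using large(1) label_H_trace u u0 by metis
      then obtain v where "anchor u = {u, v}" using anchor(6)[OF u(1)] u(2) large(2) by auto
      then show ?thesis by (simp add: card_insert_if)
    qed
    obtain \<phi>0 where e0: "emb \<phi>0 (anchor u0 \<union> anchor v0)" using two_anchors[OF u0 v0(1)] .
    define w where "w = \<phi>0 v0"
    have wK: "w \<in> K (label_H v0)" unfolding w_def by (rule emb_K[OF v0(1) e0]) blast
    have uK: "\<phi>0 u0 \<in> K ?l" by (rule emb_K[OF u0 e0]) blast
    have wu: "(w, \<phi>0 u0) \<in> E"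
      unfolding w_def using emb_adj[OF e0, of v0 u0] v0 H.E_sym by auto
    have cw: "card (E `` {w} \<inter> M) \<le> d" for M
      using G.degree_le[of w] G.finite_E by (meson card_mono finite_Image inf_le1 le_trans)
    show ?thesis
    proof (cases "v0 \<in> Y")
      case True
      \<comment> \<open>Every embedding sends \<open>v0\<close> to \<open>w\<close>, so keeping
        \<open>v0\<close> in \<open>Z\<close> confines the fibre to neighbours of \<open>w\<close>.
        The cost \<open>1 + 2 * (f + 1) + 3 * (d - f)\<close> has maximum \<open>3 * d + 3\<close>,
        the largest demand made on \<open>r\<close>.\<close>
      have Kv: "K (label_H v0) = {w}" using True wK by (auto simp: Y_def card_1_singleton_iff)
      show ?thesis
      proof (rule fiber_card_le[of "E `` {w} \<inter> K ?l" ?l "{v0}" ?B 2])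
        fix \<phi> S u
        assume u: "u \<in> D" "label_H u = ?l" "nbr_labels_H u = ?B" and e: "emb \<phi> S" and S: "{v0} \<union> anchor u \<subseteq> S"
        have "(u, v0) \<in> F" using nbr_labels_H_iff[OF True] u(3) v0(3) by metis
        then have "(\<phi> v0, \<phi> u) \<in> E"
          using emb_adj[OF e, of v0 u] S anchor(1)[OF u(1)] H.E_sym by blast
        moreover have "anchor v0 \<subseteq> S" using anchor(5)[OF v0(1) v0(4)] S by simp
        then have "\<phi> v0 = w" using emb_K[OF v0(1) e] Kv by blast
        ultimately show "\<phi> u \<in> E `` {w} \<inter> K ?l" using emb_K[OF u(1) e] S u(2) by auto
      next
        fix f assume "f \<le> card (E `` {w} \<inter> K ?l)"
        then show "card {v0} + (f + 1) * 2 + 3 * (card (E `` {w} \<inter> K ?l) - f) \<le> r"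
          using cw[of "K ?l"] r_bounds(2) by simp
      qed (use two v0W in auto)
    next
      case False
      have "K (label_H v0) \<noteq> {w}" using False v0(1) by (auto simp: Y_def)
      \<comment> \<open>Having a companion \<open>w'\<close> in its group and a neighbour in
        \<open>K ?l\<close>, the vertex \<open>w\<close> is adjacent to all of \<open>K ?l\<close>
        by homogeneity, which bounds this group by \<open>d\<close>.\<close>
      then obtain w' where w': "w' \<in> K (label_H v0)" "w' \<noteq> w" using wK by blast
      have tw: "trace E X w \<noteq> {}" using K_trace[OF wK] v0(4) label_H_trace[OF v0(1)] by simp
      have "K ?l \<subseteq> E `` {w} \<inter> K ?l"
      proof
        fix q assume q: "q \<in> K ?l"
        have tq: "trace E X s = {}" if "s \<in> K ?l" for s
          using K_trace[OF that] large(1) label_H_trace[OF u0] by simp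
        have "(w, q) \<in> E"
          by (rule homogeneousD[OF homog, of w w' "\<phi>0 u0" q])
            (use wK w' uK q wu tw tq in \<open>auto simp: K_def C_def\<close>)
        then show "q \<in> E `` {w} \<inter> K ?l" using q by blast
      qed
      then have cK: "card (K ?l) \<le> d" using cw[of "K ?l"] by (metis inf.absorb2 inf.cobounded2 subset_antisym)
      show ?thesis
      proof (rule fiber_card_le[of "K ?l" ?l "{}" ?B 2])
        fix f assume "f \<le> card (K ?l)"
        then show "card {} + (f + 1) * 2 + 3 * (card (K ?l) - f) \<le> r" using cK r_bounds(2) by simp
      qed (use in_K two in auto)
    qed
  qed
qed

text \<open>Homogeneity replaces one end at a time. The intermediate pair \<open>(p, q')\<close>
  fails when its ends coincide; then \<open>(p', q)\<close> is used, and if its ends coincide too,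
  the second pair is the first reversed.\<close>

lemma homogeneous_pairs:
  assumes "p \<in> K l" "p' \<in> K l" "q \<in> K m" "q' \<in> K m" "p \<noteq> q" "p' \<noteq> q'"
    and cl: "card (K l) \<noteq> 1" and cm: "card (K m) \<noteq> 1" and "(p, q) \<in> E"
  shows "(p', q') \<in> E"
proof -
  have step: "(v, u') \<in> E" if "v \<in> K n" "card (K n) \<noteq> 1" "u \<in> K k" "u' \<in> K k" "u \<noteq> v" "u' \<noteq> v" "(v, u) \<in> E"
    for v u u' n k
  proof -
    have "K n \<noteq> {v}" using that(2) by auto
    with \<open>v \<in> K n\<close> obtain v' where "v' \<in> K n" "v' \<noteq> v" by blast
    then show ?thesis using homogeneousD[OF homog, of v v' u u'] that by (auto simp: K_def C_def)
  qed
  show ?thesis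
  proof (cases "p = q'")
    case False
    have "(p, q') \<in> E" using step[OF assms(1) cl assms(3,4)] assms False by auto
    then have "(q', p') \<in> E" using step[OF assms(4) cm assms(1,2)] assms False G.E_sym by auto
    then show ?thesis by (rule G.E_sym)
  next
    case True
    show ?thesis
    proof (cases "q = p'")
      case True2: True
      then show ?thesis using True assms(9) G.E_sym by blast
    next
      case False
      have "(q, p') \<in> E" using step[OF assms(3) cm assms(1,2)] assms False G.E_sym by auto
      then have "(p', q) \<in> E" by (rule G.E_sym)
      then show ?thesis using step[OF assms(2) cl assms(3,4)] assms False by auto
    qed
  qed
qed

section \<open>From counts to an isomorphism of the cores\<close>

lemma core_injection:
  obtains \<psi> where "inj_on \<psi> D" "\<psi> ` D \<subseteq> C"
    "\<And>u. u \<in> D \<Longrightarrow> label E X (\<psi> u) = label_H u" "\<And>u. u \<in> D \<Longrightarrow> nbr_labels_G (\<psi> u) = nbr_labels_H u"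
proof -
  have le: "card {u \<in> D. (label_H u, nbr_labels_H u) = (label_H v, nbr_labels_H v)}
      \<le> card {q \<in> C. (label E X q, nbr_labels_G q) = (label_H v, nbr_labels_H v)}" if "v \<in> D" for v
    using fiber_card_le_label[OF that] by simp
  show thesis
  proof (rule label_preserving_injection[OF finite_D finite_C le])
    fix \<psi> assume \<psi>: "inj_on \<psi> D" "\<psi> ` D \<subseteq> C"
      "\<And>v. v \<in> D \<Longrightarrow> (label E X (\<psi> v), nbr_labels_G (\<psi> v)) = (label_H v, nbr_labels_H v)"
    show thesis by (rule that[OF \<psi>(1,2)]) (use \<psi>(3) in auto)
  qed
qed

lemma h_inj: "inj_on h X"
  using local_emb unfolding locally_embeds_def by (metis card.empty empty_subsetI inj_on_inverseI zero_le)

lemma card_core_split: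
  "card (core V E) = card C + card X" "card (core W F) = card D + card (core W F \<inter> h ` X)"
  "card (core W F \<inter> h ` X) \<le> card X"
proof -
  have fX: "finite X" using X_core G.core_subset G.finite_V by (meson finite_subset)
  have fW: "finite (core W F)" using H.core_subset H.finite_V finite_subset by blast
  show "card (core V E) = card C + card X"
    unfolding C_def using X_core fX by (metis card_Diff_subset card_mono finite_Diff2 finite_subset G.core_subset G.finite_V le_add_diff_inverse2)
  show "card (core W F) = card D + card (core W F \<inter> h ` X)"
    unfolding D_def using fW by (metis add.commute card_Int_Diff)
  show "card (core W F \<inter> h ` X) \<le> card X"
    using fX by (metis card_image_le card_mono finite_imageI inf_le2 le_trans)
qed

lemma card_core_le: "card (core W F) \<le> card (core V E)"
  by (metis (no_types) core_injection card_core_split add_le_mono card_inj_on_le finite_C)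

text \<open>Equality forces \<open>\<psi>\<close> to be onto and the placed base to lie in the core.
  Adjacency to the base is then given by traces, adjacency to \<open>Y\<close> by
  \<open>nbr_labels_G\<close>, and all the rest by homogeneity.\<close>

lemma core_isomorphism:
  assumes eq: "card (core W F) = card (core V E)"
  obtains \<Psi> where "bij_betw \<Psi> (core W F) (core V E)"
    "\<And>u v. u \<in> core W F \<Longrightarrow> v \<in> core W F \<Longrightarrow> (u, v) \<in> F \<longleftrightarrow> (\<Psi> u, \<Psi> v) \<in> E"
proof -
  obtain \<psi> where \<psi>: "inj_on \<psi> D" "\<psi> ` D \<subseteq> C"
    "\<And>u. u \<in> D \<Longrightarrow> label E X (\<psi> u) = label_H u" "\<And>u. u \<in> D \<Longrightarrow> nbr_labels_G (\<psi> u) = nbr_labels_H u"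
    by (rule core_injection) blast
  have fX: "finite X" using X_core G.core_subset G.finite_V by (meson finite_subset)
  have "card D \<le> card C" using \<psi>(1,2) finite_C by (metis card_inj_on_le)
  then have cD: "card D = card C" and cX: "card (core W F \<inter> h ` X) = card X"
    using card_core_split eq by linarith+
  have "card (core W F \<inter> h ` X) = card (h ` X)" using cX card_image[OF h_inj] by simp
  then have "core W F \<inter> h ` X = h ` X" using fX by (metis card_subset_eq finite_imageI inf_le2)
  then have hX: "h ` X \<subseteq> core W F" by blast
  have im: "\<psi> ` D = C" using \<psi>(1,2) cD finite_C by (metis card_image card_subset_eq)
  obtain \<phi>0 where e0: "emb \<phi>0 {}" using emb_exists[of "{}"] by auto
  define \<Psi> where "\<Psi> u = (if u \<in> h ` X then \<phi>0 u else \<psi> u)" for u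
  have \<phi>0: "\<phi>0 (h x) = x" if "x \<in> X" for x using e0 that by (simp add: emb_def)
  have \<Psi>h: "\<Psi> (h x) = x" if "x \<in> X" for x using \<phi>0 that by (simp add: \<Psi>_def)
  have \<Psi>D: "\<Psi> u = \<psi> u" if "u \<in> D" for u using that by (simp add: \<Psi>_def D_def)
  have \<psi>K: "\<psi> u \<in> K (label_H u)" if "u \<in> D" for u using \<psi>(2,3) that by (auto simp: K_def)
  have cases: "u \<in> D \<or> (\<exists>x\<in>X. u = h x)" if "u \<in> core W F" for u using that by (auto simp: D_def)
  have "bij_betw \<psi> D C" using \<psi>(1) im by (simp add: bij_betw_def)
  then have "bij_betw \<Psi> D C" using \<Psi>D by (simp cong: bij_betw_cong)
  moreover have "bij_betw \<Psi> (h ` X) X"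
  proof (rule bij_betw_imageI)
    show "inj_on \<Psi> (h ` X)" using \<Psi>h by (auto intro!: inj_onI)
    show "\<Psi> ` h ` X = X" using \<Psi>h by force
  qed
  ultimately have "bij_betw \<Psi> (D \<union> h ` X) (C \<union> X)"
    by (rule bij_betw_combine) (auto simp: C_def)
  moreover have "D \<union> h ` X = core W F" "C \<union> X = core V E"
    using hX X_core by (auto simp: D_def C_def)
  ultimately have bij: "bij_betw \<Psi> (core W F) (core V E)" by simp
  have DX: "(u, h x) \<in> F \<longleftrightarrow> (\<Psi> u, x) \<in> E" if u: "u \<in> D" and x: "x \<in> X" for u x
  proof -
    have "(u, h x) \<in> F \<longleftrightarrow> x \<in> snd (label_H u)" using label_H_trace[OF u] x by (simp add: trace_H_def)
    also have "snd (label_H u) = trace E X (\<psi> u)" using \<psi>(3)[OF u] by (metis label_def snd_conv)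
    finally show ?thesis using x \<Psi>D[OF u] by (simp add: trace_def)
  qed
  have DY: "(u, y) \<in> F \<longleftrightarrow> (\<Psi> u, \<Psi> y) \<in> E" if u: "u \<in> D" and y: "y \<in> Y" for u y
  proof -
    have yD: "y \<in> D" using y by (simp add: Y_def)
    have "(u, y) \<in> F \<longleftrightarrow> label_H y \<in> nbr_labels_G (\<psi> u)" using nbr_labels_H_iff[OF y] \<psi>(4)[OF u] by simp
    also have "\<dots> \<longleftrightarrow> (\<psi> u, \<psi> y) \<in> E" by (rule nbr_labels_G_iff[OF y \<psi>K[OF yD]])
    finally show ?thesis using \<Psi>D u yD by simp
  qed
  have symF: "(u, v) \<in> F \<longleftrightarrow> (v, u) \<in> F" for u v using H.E_sym by blast
  have symE: "(u, v) \<in> E \<longleftrightarrow> (v, u) \<in> E" for u v using G.E_sym by blast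
  have DD: "(u, v) \<in> F \<longleftrightarrow> (\<Psi> u, \<Psi> v) \<in> E" if u: "u \<in> D" and v: "v \<in> D" for u v
  proof -
    consider "v \<in> Y" | "u \<in> Y" | "u = v" | (big) "u \<notin> Y" "v \<notin> Y" "u \<noteq> v" by blast
    then show ?thesis
    proof cases
      case 1
      then show ?thesis using DY u by blast
    next
      case 2
      then show ?thesis using DY[OF v 2] symF symE by blast
    next
      case 3
      then show ?thesis using H.E_irrefl G.E_irrefl by blast
    next
      \<comment> \<open>The embedding and \<open>\<psi>\<close> send \<open>u\<close> into the same
        group, and likewise \<open>v\<close>; neither group is a single vertex.\<close>
      case big
      then have c: "card (K (label_H u)) \<noteq> 1" "card (K (label_H v)) \<noteq> 1" using u v by (auto simp: Y_def)
      obtain \<phi> where e: "emb \<phi> (anchor u \<union> anchor v)" using two_anchors[OF u v] .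
      have K: "\<phi> u \<in> K (label_H u)" "\<phi> v \<in> K (label_H v)"
        using emb_K[OF u e] emb_K[OF v e] by auto
      have uv: "u \<in> anchor u \<union> anchor v" "v \<in> anchor u \<union> anchor v" using anchor(1) u v by blast+
      have ne: "\<phi> u \<noteq> \<phi> v" "\<psi> u \<noteq> \<psi> v"
        using emb_inj[OF e uv] \<psi>(1) u v big(3) by (auto dest: inj_onD)
      have "(u, v) \<in> F \<longleftrightarrow> (\<phi> u, \<phi> v) \<in> E" using emb_adj[OF e uv] by simp
      also have "\<dots> \<longleftrightarrow> (\<psi> u, \<psi> v) \<in> E"
        using homogeneous_pairs[OF K(1) \<psi>K[OF u] K(2) \<psi>K[OF v] ne c]
          homogeneous_pairs[OF \<psi>K[OF u] K(1) \<psi>K[OF v] K(2) ne(2,1) c] by blast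
      finally show ?thesis using \<Psi>D u v by simp
    qed
  qed
  have XX: "(h x, h x') \<in> F \<longleftrightarrow> (x, x') \<in> E" if "x \<in> X" "x' \<in> X" for x x'
    using e0 that \<phi>0 by (simp add: emb_def partial_embedding_def)
  have "(u, v) \<in> F \<longleftrightarrow> (\<Psi> u, \<Psi> v) \<in> E" if "u \<in> core W F" "v \<in> core W F" for u v
    using cases[OF that(1)] cases[OF that(2)]
  proof (elim disjE bexE)
    fix x assume "u \<in> D" "x \<in> X" "v = h x"
    then show ?thesis using DX \<Psi>h by simp
  next
    fix x assume "v \<in> D" "x \<in> X" "u = h x"
    then show ?thesis using DX[of v x] \<Psi>h symF[of "h x" v] symE[of x "\<Psi> v"] by simp
  next
    fix x x' assume "x \<in> X" "u = h x" "x' \<in> X" "v = h x'"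
    then show ?thesis using XX \<Psi>h by simp
  qed (rule DD)
  with bij that show thesis by blast
qed

end

section \<open>Isolated vertices and isolated edges\<close>

definition isomorphism :: "'a set \<Rightarrow> 'a rel \<Rightarrow> 'b set \<Rightarrow> 'b rel \<Rightarrow> ('a \<Rightarrow> 'b) \<Rightarrow> bool" where
  "isomorphism V E W F f \<longleftrightarrow> bij_betw f V W \<and> (\<forall>u\<in>V. \<forall>v\<in>V. (u, v) \<in> E \<longleftrightarrow> (f u, f v) \<in> F)"

lemma isomorphism_union:
  assumes f: "isomorphism A E A' F f" and g: "isomorphism B E B' F g"
    and disj: "A \<inter> B = {}" "A' \<inter> B' = {}"
    and E: "\<And>u v. u \<in> A \<Longrightarrow> v \<in> B \<Longrightarrow> (u, v) \<notin> E \<and> (v, u) \<notin> E"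
    and F: "\<And>u v. u \<in> A' \<Longrightarrow> v \<in> B' \<Longrightarrow> (u, v) \<notin> F \<and> (v, u) \<notin> F"
  obtains h where "isomorphism (A \<union> B) E (A' \<union> B') F h"
proof -
  define h where "h v = (if v \<in> A then f v else g v)" for v
  have hA: "h v = f v" if "v \<in> A" for v using that by (simp add: h_def)
  have hB: "h v = g v" if "v \<in> B" for v using that disj(1) by (auto simp: h_def)
  have fA: "f v \<in> A'" if "v \<in> A" for v using f that by (auto simp: isomorphism_def bij_betw_def)
  have gB: "g v \<in> B'" if "v \<in> B" for v using g that by (auto simp: isomorphism_def bij_betw_def)
  have "bij_betw h A A'" "bij_betw h B B'"
    using f g bij_betw_cong[of A h f A'] bij_betw_cong[of B h g B'] hA hB by (simp_all add: isomorphism_def)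
  then have "bij_betw h (A \<union> B) (A' \<union> B')" using disj(2) by (rule bij_betw_combine)
  moreover have "(u, v) \<in> E \<longleftrightarrow> (h u, h v) \<in> F" if "u \<in> A \<union> B" "v \<in> A \<union> B" for u v
  proof -
    from that consider "u \<in> A" "v \<in> A" | "u \<in> A" "v \<in> B" | "u \<in> B" "v \<in> A" | "u \<in> B" "v \<in> B" by blast
    then show ?thesis
    proof cases
      case 1 then show ?thesis using f hA by (simp add: isomorphism_def)
    next
      case 2 then show ?thesis using E F hA hB fA gB by simp
    next
      case 3 then show ?thesis using E F hA hB fA gB by simp
    next
      case 4 then show ?thesis using g hB by (simp add: isomorphism_def)
    qed
  qed
  ultimately show thesis using that unfolding isomorphism_def by blast
qed

text \<open>A maximal set disjoint from its image meets every orbit.\<close>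

lemma half_of_involution:
  assumes fin: "finite J" and s: "\<And>v. v \<in> J \<Longrightarrow> s v \<in> J \<and> s (s v) = v \<and> s v \<noteq> v"
  obtains J1 where "J1 \<subseteq> J" "J1 \<inter> s ` J1 = {}" "J = J1 \<union> s ` J1"
proof -
  let ?A = "{J1. J1 \<subseteq> J \<and> J1 \<inter> s ` J1 = {}}"
  have "finite ?A" using fin by simp
  moreover have "{} \<in> ?A" by simp
  ultimately obtain J1 where J1: "J1 \<in> ?A" and max: "\<forall>K\<in>?A. J1 \<subseteq> K \<longrightarrow> J1 = K"
    using finite_has_maximal2[of ?A "{}"] by auto
  have "v \<in> J1 \<union> s ` J1" if v: "v \<in> J" for v
  proof (rule ccontr)
    assume n: "v \<notin> J1 \<union> s ` J1"
    have "s v \<notin> J1"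
    proof
      assume "s v \<in> J1"
      then have "s (s v) \<in> s ` J1" by (rule imageI)
      then show False using n s[OF v] by simp
    qed
    then have "insert v J1 \<inter> s ` insert v J1 = {}" using n J1 s[OF v] by auto
    then have "insert v J1 \<in> ?A" using v J1 by simp
    then have "J1 = insert v J1" using max by blast
    then show False using n by blast
  qed
  moreover have "s ` J1 \<subseteq> J" using J1 s by blast
  ultimately show thesis using that[of J1] J1 by blast
qed

context sym_graph
begin

definition isolated :: "'a set" where
  "isolated = {v \<in> V. E `` {v} = {}}"

text \<open>The ends of isolated edges: components outside the core have at most two
  vertices.\<close>

definition paired :: "'a set" where
  "paired = V - core V E - isolated"

definition mate :: "'a \<Rightarrow> 'a" where
  "mate v = (THE u. (v, u) \<in> E)"

lemma paired_nbrs: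
  assumes v: "v \<in> paired" and "(v, u) \<in> E"
  shows "u \<in> paired" "E `` {v} = {u}" "E `` {u} = {v}"
proof -
  have u: "u \<in> V" "(u, v) \<in> E" using assms E_inV E_sym by blast+
  have "\<not> (w \<noteq> v \<and> w \<noteq> u \<and> ((v, w) \<in> E \<or> (u, w) \<in> E))" for w
    using assms unfolding paired_def core_def by blast
  then have "\<And>w. (v, w) \<in> E \<Longrightarrow> w = u" "\<And>w. (u, w) \<in> E \<Longrightarrow> w = v" using E_irrefl by metis+
  then show "E `` {v} = {u}" "E `` {u} = {v}" using assms(2) u by blast+
  have "u \<notin> core V E" using core_adj[OF _ u(2)] v by (auto simp: paired_def)
  then show "u \<in> paired" using u by (auto simp: paired_def isolated_def)
qed

lemma mate:
  assumes "v \<in> paired"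
  shows "(v, mate v) \<in> E" "E `` {v} = {mate v}" "mate v \<in> paired" "mate (mate v) = v" "mate v \<noteq> v"
proof -
  obtain u where u: "(v, u) \<in> E" using assms by (auto simp: paired_def isolated_def)
  have "mate v = u" unfolding mate_def using paired_nbrs(2)[OF assms u] u by blast
  moreover have "mate u = v" unfolding mate_def using paired_nbrs(3)[OF assms u] E_sym[OF u] by blast
  ultimately show "(v, mate v) \<in> E" "E `` {v} = {mate v}" "mate v \<in> paired" "mate (mate v) = v" "mate v \<noteq> v"
    using u paired_nbrs[OF assms u] E_irrefl by auto
qed

lemma paired_adj_iff: "v \<in> paired \<Longrightarrow> (v, u) \<in> E \<longleftrightarrow> u = mate v"
  using mate(2)[of v] by blast

lemma V_split: "V = core V E \<union> isolated \<union> paired" "core V E \<inter> isolated = {}"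
    "(core V E \<union> isolated) \<inter> paired = {}"
  using core_subset by (auto simp: paired_def isolated_def core_def)

lemma finite_parts: "finite (core V E)" "finite isolated" "finite paired"
  using V_split(1) finite_V by (metis finite_Un)+

lemma card_split: "card V = card (core V E) + card isolated + card paired"
proof -
  have "card V = card (core V E \<union> isolated \<union> paired)" using V_split(1) by simp
  also have "\<dots> = card (core V E) + card isolated + card paired"
    using V_split(2,3) finite_parts by (simp add: card_Un_disjoint)
  finally show ?thesis .
qed

lemma isolated_no_edges: "v \<in> isolated \<Longrightarrow> (v, u) \<notin> E \<and> (u, v) \<notin> E"
  using E_sym by (auto simp: isolated_def)

lemma paired_half:
  obtains J1 where "J1 \<subseteq> paired" "J1 \<inter> mate ` J1 = {}" "paired = J1 \<union> mate ` J1" "card paired = 2 * card J1"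
    "inj_on mate J1"
proof -
  obtain J1 where J1: "J1 \<subseteq> paired" "J1 \<inter> mate ` J1 = {}" "paired = J1 \<union> mate ` J1"
    using half_of_involution[OF finite_parts(3), of mate] mate(3-5) by metis
  have inj: "inj_on mate J1" by (rule inj_onI) (metis J1(1) mate(4) subsetD)
  have "finite J1" using J1(1) finite_parts(3) finite_subset by blast
  then have "card (J1 \<union> mate ` J1) = 2 * card J1"
    using J1(2) card_image[OF inj] by (simp add: card_Un_disjoint)
  then show thesis using that[of J1] J1 inj by metis
qed

end

section \<open>One-sided and two-sided comparison by simulation\<close>

lemma locally_embedsD:
  assumes "locally_embeds r V E X h W F" "S \<subseteq> W" "card S \<le> r"
  obtains \<phi> where "partial_embedding F V E \<phi> (S \<union> h ` X)" "\<And>x. x \<in> X \<Longrightarrow> \<phi> (h x) = x"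
proof -
  have "\<exists>\<phi>. partial_embedding F V E \<phi> (S \<union> h ` X) \<and> (\<forall>x\<in>X. \<phi> (h x) = x)"
    using assms by (simp add: locally_embeds_def)
  then show thesis using that by metis
qed

lemma locally_embeds_base:
  assumes "locally_embeds r V E X h W F"
  shows "h ` X \<subseteq> W" "inj_on h X" "\<And>x y. x \<in> X \<Longrightarrow> y \<in> X \<Longrightarrow> (h x, h y) \<in> F \<longleftrightarrow> (x, y) \<in> E"
proof -
  obtain \<phi> where \<phi>: "partial_embedding F V E \<phi> ({} \<union> h ` X)" "\<And>x. x \<in> X \<Longrightarrow> \<phi> (h x) = x"
    by (rule locally_embedsD[OF assms, of "{}"]) auto
  show "h ` X \<subseteq> W" using assms by (simp add: locally_embeds_def)
  show "inj_on h X" by (rule inj_on_inverseI[of X \<phi>]) (rule \<phi>(2))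
  show "\<And>x y. x \<in> X \<Longrightarrow> y \<in> X \<Longrightarrow> (h x, h y) \<in> F \<longleftrightarrow> (x, y) \<in> E"
    using \<phi> by (simp add: partial_embedding_def)
qed

lemma locally_embeds_vertex:
  assumes "locally_embeds r V E X h W F" "1 \<le> r" "w \<in> W"
  obtains y where "y \<in> V" "\<And>x. x \<in> X \<Longrightarrow> (h x, w) \<in> F \<longleftrightarrow> (x, y) \<in> E" "\<And>x. x \<in> X \<Longrightarrow> w = h x \<longleftrightarrow> y = x"
proof -
  obtain \<phi> where \<phi>: "partial_embedding F V E \<phi> ({w} \<union> h ` X)" "\<And>x. x \<in> X \<Longrightarrow> \<phi> (h x) = x"
    by (rule locally_embedsD[OF assms(1), of "{w}"]) (use assms in auto)
  show thesis
  proof (rule that[of "\<phi> w"])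
    show "\<phi> w \<in> V" using \<phi>(1) by (simp add: partial_embedding_def)
    fix x assume x: "x \<in> X"
    show "(h x, w) \<in> F \<longleftrightarrow> (x, \<phi> w) \<in> E" using \<phi> x by (auto simp: partial_embedding_def)
    show "w = h x \<longleftrightarrow> \<phi> w = x"
      using \<phi>(1) \<phi>(2)[OF x] x unfolding partial_embedding_def inj_on_def by (metis UnCI imageI insertI1)
  qed
qed

text \<open>The empty base suffices. A violation of symmetry or irreflexivity involves at most two
  vertices, one of the degree bound \<open>d + 2\<close>, and none of them embeds into a graph of
  maximum degree \<open>d\<close>. This is how arbitrary binary relations are excluded.\<close>

lemma bounded_graph_if_simulates:
  assumes G: "bounded_graph V E d" and W: "finite W" "F \<subseteq> W \<times> W"
    and sim: "simulates k r V E W F" and r: "d + 2 \<le> r"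
  shows "bounded_graph W F d"
proof -
  interpret G: bounded_graph V E d by (rule G)
  obtain h where "locally_embeds r V E {} h W F" using sim by (force simp: simulates_def)
  then have emb: "\<exists>\<phi>. partial_embedding F V E \<phi> S" if "S \<subseteq> W" "card S \<le> r" for S
    using that by (auto simp: locally_embeds_def)
  show ?thesis
  proof
    show "finite W" "F \<subseteq> W \<times> W" by (rule W)+
    fix u v
    show "(v, u) \<in> F" if "(u, v) \<in> F"
    proof -
      have "card {u, v} \<le> r" using r by (simp add: card_insert_if)
      moreover have "{u, v} \<subseteq> W" using that W(2) by auto
      ultimately obtain \<phi> where "partial_embedding F V E \<phi> {u, v}" using emb by blast
      then show ?thesis using that G.E_sym[of "\<phi> u" "\<phi> v"] by (simp add: partial_embedding_def)
    qed
    show "(v, v) \<notin> F"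
    proof
      assume v: "(v, v) \<in> F"
      then obtain \<phi> where "partial_embedding F V E \<phi> {v}" using emb[of "{v}"] W(2) r by auto
      then show False using v G.E_irrefl[of "\<phi> v"] by (simp add: partial_embedding_def)
    qed
    show "card (F `` {v}) \<le> d"
    proof (rule ccontr)
      assume "\<not> ?thesis"
      then have "d + 1 \<le> card (F `` {v})" by simp
      then obtain T where T: "T \<subseteq> F `` {v}" "card T = d + 1" "finite T"
        by (rule obtain_subset_with_card_n)
      then have "T \<noteq> {}" by auto
      then have "insert v T \<subseteq> W" using T(1) W(2) by auto
      moreover have "card (insert v T) \<le> r" using T(2,3) r by (simp add: card_insert_if)
      ultimately obtain \<phi> where \<phi>: "partial_embedding F V E \<phi> (insert v T)" using emb by blast
      then have "\<phi> ` T \<subseteq> E `` {\<phi> v}" using T(1) unfolding partial_embedding_def by auto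
      then have "card (\<phi> ` T) \<le> card (E `` {\<phi> v})" by (rule card_mono[OF finite_Image[OF G.finite_E]])
      moreover have "card (\<phi> ` T) = card T"
        using \<phi> by (intro card_image) (auto simp: partial_embedding_def)
      ultimately show False using T(2) G.degree_le[of "\<phi> v"] by simp
    qed
  qed
qed

text \<open>The core is closed under adjacency, so discarding the rest of \<open>X\<close> changes
  no label inside the core.\<close>

lemma (in bounded_graph) exists_core_base:
  assumes "2 \<le> d"
  obtains X where "X \<subseteq> core V E" "homogeneous (core V E) E X" "sparse_untraced (core V E) E X"
    "2 * card X * d ^ 10 + card V \<le> card V * d ^ 10"
proof -
  obtain X where X: "X \<subseteq> V" "homogeneous V E X" "sparse_untraced V E X"
    "2 * card X * d ^ 10 + card V \<le> card V * d ^ 10"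
    by (rule exists_small_base[OF assms])
  let ?X = "X \<inter> core V E"
  have tr: "trace E ?X v = trace E X v" if "v \<in> core V E" for v
    using core_adj[OF that] by (auto simp: trace_def)
  have lab: "label E ?X v = label E X v" if "v \<in> core V E" for v
    using tr[OF that] by (simp add: label_def)
  have sub: "core V E - ?X \<subseteq> V - X" using core_subset by blast
  have "homogeneous (core V E) E ?X"
    unfolding homogeneous_def
  proof (intro ballI impI, elim conjE)
    fix v v' u u'
    assume *: "v \<in> core V E - ?X" "v' \<in> core V E - ?X" "u \<in> core V E - ?X" "u' \<in> core V E - ?X"
      "v' \<noteq> v" "label E ?X v' = label E ?X v" "u \<noteq> v" "u' \<noteq> v" "label E ?X u = label E ?X u'" "(v, u) \<in> E"
    show "(v, u') \<in> E"
      by (rule homogeneousD[OF X(2), of v v' u u']) (use * lab sub in auto)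
  qed
  moreover have "sparse_untraced (core V E) E ?X"
    unfolding sparse_untraced_def
  proof (intro ballI impI, elim conjE)
    fix a b c
    assume *: "a \<in> core V E - ?X" "b \<in> core V E - ?X" "c \<in> core V E - ?X" "a \<noteq> b" "b \<noteq> c" "a \<noteq> c"
      "trace E ?X a = {}" "label E ?X a = label E ?X b" "label E ?X b = label E ?X c"
    have "a \<in> V - X" "b \<in> V - X" "c \<in> V - X" using * sub by blast+
    moreover have "trace E X a = {}" "label E X a = label E X b" "label E X b = label E X c"
      using * tr lab by auto
    ultimately show "(a, b) \<notin> E" using X(3) *(4-6) unfolding sparse_untraced_def by blast
  qed
  moreover have "2 * card ?X * d ^ 10 + card V \<le> card V * d ^ 10"
  proof -
    have "card ?X \<le> card X" using X(1) finite_V by (meson card_mono finite_subset inf_le1)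
    then have "2 * card ?X * d ^ 10 \<le> 2 * card X * d ^ 10" by (intro mult_right_mono) auto
    then show ?thesis using X(4) by linarith
  qed
  ultimately show thesis using that[of ?X] by blast
qed

text \<open>The hypothesis on \<open>k\<close> says that a base of the size promised by
  \<open>exists_core_base\<close> has at most \<open>k\<close> vertices. Stating it for every
  \<open>m\<close> avoids division and rounding.\<close>

lemma core_comparison:
  assumes G: "bounded_graph V E d" and H: "sym_graph W F" and d: "2 \<le> d" and r: "d\<^sup>2 + d + 3 \<le> r"
    and sim: "simulates k r V E W F"
    and k: "\<And>m. 2 * m * d ^ 10 + card V \<le> card V * d ^ 10 \<Longrightarrow> m \<le> k"
  shows "card (core W F) \<le> card (core V E)"
    and "card (core W F) = card (core V E) \<Longrightarrow> \<exists>\<Psi>. isomorphism (core W F) F (core V E) E \<Psi>"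
proof -
  interpret G: bounded_graph V E d by (rule G)
  interpret H: sym_graph W F by (rule H)
  obtain X where X: "X \<subseteq> core V E" "homogeneous (core V E) E X" "sparse_untraced (core V E) E X"
    "2 * card X * d ^ 10 + card V \<le> card V * d ^ 10"
    by (rule G.exists_core_base[OF d])
  have "X \<subseteq> V" using X(1) G.core_subset by blast
  then obtain h where h: "locally_embeds r V E X h W F"
    using sim k[OF X(4)] unfolding simulates_def by blast
  interpret base_extension V E d W F X h r
    by unfold_locales (use X h d r in auto)
  show "card (core W F) \<le> card (core V E)" by (rule card_core_le)
  show "\<exists>\<Psi>. isomorphism (core W F) F (core V E) E \<Psi>" if eq: "card (core W F) = card (core V E)"
  proof -
    obtain \<Psi> where "bij_betw \<Psi> (core W F) (core V E)"
      "\<And>u v. u \<in> core W F \<Longrightarrow> v \<in> core W F \<Longrightarrow> (u, v) \<in> F \<longleftrightarrow> (\<Psi> u, \<Psi> v) \<in> E"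
      by (rule core_isomorphism[OF eq]) blast
    then show ?thesis unfolding isomorphism_def by blast
  qed
qed

text \<open>The size bound grows with the order, so a base of a graph that is no larger also fits
  into \<open>k\<close>.\<close>

lemma small_base_mono:
  fixes d :: nat
  assumes "2 * m * d ^ 10 + N \<le> N * d ^ 10" "N \<le> M" "1 \<le> d"
  shows "2 * m * d ^ 10 + M \<le> M * d ^ 10"
proof -
  have "(M - N) * 1 \<le> (M - N) * d ^ 10" using assms(3) by (intro mult_left_mono) auto
  moreover have "M * d ^ 10 = N * d ^ 10 + (M - N) * d ^ 10"
    using assms(2) by (simp add: add_mult_distrib[symmetric])
  ultimately show ?thesis using assms(1,2) by linarith
qed

text \<open>The order of \<open>W\<close> is unknown at first. Placing a base of \<open>V\<close> in
  \<open>W\<close> shows that \<open>W\<close> is no larger; only then is a base of \<open>W\<close>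
  known to fit into \<open>k\<close>, and placing it in \<open>V\<close> gives the reverse
  inequality and the isomorphism.\<close>

theorem isomorphism_if_all_core:
  assumes G: "bounded_graph V E d" and H: "finite W" "F \<subseteq> W \<times> W"
    and cores: "core V E = V" "core W F = W"
    and d: "2 \<le> d" and r: "d\<^sup>2 + d + 3 \<le> r"
    and sim: "simulates k r V E W F" "simulates k r W F V E"
    and k: "\<And>m. 2 * m * d ^ 10 + card V \<le> card V * d ^ 10 \<Longrightarrow> m \<le> k"
  shows "\<exists>\<Psi>. isomorphism V E W F \<Psi>"
proof -
  have "d + 2 \<le> r" using r by simp
  then have H': "bounded_graph W F d" by (rule bounded_graph_if_simulates[OF G H sim(1)])
  have symG: "sym_graph V E" and symH: "sym_graph W F"
    using G H' by (auto dest: bounded_graph.axioms)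
  have le: "card W \<le> card V" using core_comparison(1)[OF G symH d r sim(1) k] cores by simp
  have kW: "m \<le> k" if "2 * m * d ^ 10 + card W \<le> card W * d ^ 10" for m
    by (rule k, rule small_base_mono[OF that le]) (use d in simp)
  have "card V \<le> card W" using core_comparison(1)[OF H' symG d r sim(2) kW] cores by simp
  with le show ?thesis using core_comparison(2)[OF H' symG d r sim(2) kW] cores by simp
qed

text \<open>A surplus of isolated vertices in \<open>W\<close> means fewer paired vertices there.
  The core of \<open>W\<close> with one end of each of its isolated edges is then small enough for a
  base, and placing it in \<open>V\<close> leaves too little room for the non-isolated vertices of
  \<open>V\<close>.\<close>

lemma isolated_le:
  assumes G: "sym_graph V E" and H: "sym_graph W F" and r: "3 \<le> r"
    and sim: "simulates k r V E W F" "simulates k r W F V E"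
    and n: "card V = card W" "card (core V E) = card (core W F)" "2 * card V < 5 * k + 4"
  shows "card (sym_graph.isolated W F) \<le> card (sym_graph.isolated V E)"
proof (rule ccontr)
  interpret G: sym_graph V E by (rule G)
  interpret H: sym_graph W F by (rule H)
  assume "\<not> ?thesis"
  then have less: "card G.isolated < card H.isolated" by simp
  then have pless: "card H.paired < card G.paired"
    using G.card_split H.card_split n(1,2) by linarith
  \<comment> \<open>Otherwise a base could hold one isolated vertex of \<open>W\<close> more than
    \<open>V\<close> has. A neighbour of its image in \<open>V\<close> would have a type over the
    base that \<open>W\<close> does not realise, so all images are isolated.\<close>
  have A: "k \<le> card G.isolated"
  proof (rule ccontr)
    assume "\<not> ?thesis"
    moreover obtain X where X: "X \<subseteq> H.isolated" "card X = card G.isolated + 1"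
      using less by (metis Suc_eq_plus1 Suc_leI obtain_subset_with_card_n)
    moreover have "X \<subseteq> W" using X(1) by (auto simp: H.isolated_def)
    ultimately obtain h where h: "locally_embeds r W F X h V E" 
      using sim(2) unfolding simulates_def by force
    have "h ` X \<subseteq> G.isolated"
    proof
      fix v assume "v \<in> h ` X"
      then obtain x where x: "x \<in> X" "v = h x" by blast
      have "(v, w) \<notin> E" for w
      proof
        assume vw: "(v, w) \<in> E"
        then have wV: "w \<in> V" using G.E_inV by blast
        obtain y where "\<And>x. x \<in> X \<Longrightarrow> (h x, w) \<in> E \<longleftrightarrow> (x, y) \<in> F"
          by (rule locally_embeds_vertex[OF h _ wV]) (use r in auto)
        then show False using vw x X(1) H.isolated_no_edges by blast
      qed
      then show "v \<in> G.isolated" using x locally_embeds_base(1)[OF h] by (auto simp: G.isolated_def)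
    qed
    then have "card X \<le> card G.isolated"
      using card_inj_on_le[OF locally_embeds_base(2)[OF h]] G.finite_parts(2) by blast
    then show False using X(2) by simp
  qed
  \<comment> \<open>Otherwise all isolated edges of \<open>V\<close> fit into one base, and their
    images in \<open>W\<close> are isolated edges again.\<close>
  have B: "k < card G.paired"
  proof (rule ccontr)
    assume "\<not> ?thesis"
    moreover have "G.paired \<subseteq> V" by (auto simp: G.paired_def)
    ultimately obtain h where h: "locally_embeds r V E G.paired h W F"
      using sim(1) unfolding simulates_def by force
    have nbr: "w = h (G.mate x)" if x: "x \<in> G.paired" and xw: "(h x, w) \<in> F" for x w
    proof -
      have wW: "w \<in> W" using xw H.E_inV by blast
      obtain y where y: "\<And>x. x \<in> G.paired \<Longrightarrow> (h x, w) \<in> F \<longleftrightarrow> (x, y) \<in> E"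
        "\<And>x. x \<in> G.paired \<Longrightarrow> w = h x \<longleftrightarrow> y = x"
        by (rule locally_embeds_vertex[OF h _ wW]) (use r in auto)
      have "y = G.mate x" using y(1)[OF x] xw G.paired_adj_iff[OF x] by blast
      then show ?thesis using y(2) G.mate(3)[OF x] by blast
    qed
    have "h ` G.paired \<subseteq> H.paired"
    proof
      fix v assume "v \<in> h ` G.paired"
      then obtain x where x: "x \<in> G.paired" "v = h x" by blast
      have "(h x, h (G.mate x)) \<in> F"
        using locally_embeds_base(3)[OF h x(1) G.mate(3)[OF x(1)]] G.mate(1)[OF x(1)] by simp
      then have "v \<notin> H.isolated" using x(2) H.isolated_no_edges by blast
      moreover have "v \<notin> core W F"
      proof
        assume "v \<in> core W F"
        then obtain u w where uw: "(v, u) \<in> F" "w \<noteq> v" "w \<noteq> u" "(v, w) \<in> F \<or> (u, w) \<in> F"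
          by (auto simp: core_def)
        have u: "u = h (G.mate x)" using nbr x uw(1) by blast
        have "(v, w) \<in> F \<Longrightarrow> w = u" using nbr x u by blast
        moreover have "(u, w) \<in> F \<Longrightarrow> w = v"
          using nbr[OF G.mate(3)[OF x(1)]] u G.mate(4)[OF x(1)] x(2) by simp
        ultimately show False using uw by blast
      qed
      ultimately show "v \<in> H.paired" using x locally_embeds_base(1)[OF h] by (auto simp: H.paired_def)
    qed
    then have "card G.paired \<le> card H.paired"
      using card_inj_on_le[OF locally_embeds_base(2)[OF h]] H.finite_parts(3) by blast
    then show False using pless by simp
  qed
  obtain J1 where J1: "J1 \<subseteq> H.paired" "J1 \<inter> H.mate ` J1 = {}" "H.paired = J1 \<union> H.mate ` J1"
    "card H.paired = 2 * card J1" "inj_on H.mate J1"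
    by (rule H.paired_half)
  have fJ1: "finite J1" using J1(1) H.finite_parts(3) finite_subset by blast
  let ?X = "core W F \<union> J1"
  have cX: "card ?X = card (core W F) + card J1"
    by (rule card_Un_disjoint) (use H.finite_parts fJ1 J1(1) H.V_split(3) in auto)
  \<comment> \<open>On failure the core has more than \<open>k - card J1\<close> vertices, at least
    \<open>k\<close> vertices of \<open>V\<close> are isolated, and the number of paired ones
    exceeds both \<open>k\<close> and \<open>2 * card J1\<close>. Together
    \<open>2 * card V \<ge> 5 * k + 4\<close>, which is where the numerical hypothesis comes
    from.\<close>
  have "card ?X \<le> k"
  proof (rule ccontr)
    assume "\<not> ?thesis"
    then show False using A B cX J1(4) pless G.card_split n(2,3) by linarith
  qed
  moreover have XW: "?X \<subseteq> W" using J1(1) H.core_subset by (auto simp: H.paired_def)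
  ultimately obtain h where h: "locally_embeds r W F ?X h V E"
    using sim(2) unfolding simulates_def by force
  let ?O = "V - G.isolated - h ` ?X"
  \<comment> \<open>A non-isolated vertex of \<open>V\<close> off the placed base looks like the
    mate of an element of \<open>J1\<close>. Each element of \<open>J1\<close> can account for only
    one such vertex.\<close>
  have outside: "\<exists>x. x \<in> J1 \<and> (h x, w) \<in> E" if w: "w \<in> ?O" for w
  proof -
    obtain w2 where w2: "(w, w2) \<in> E" using w by (auto simp: G.isolated_def)
    have "card {w, w2} \<le> r" using r by (simp add: card_insert_if)
    moreover have "{w, w2} \<subseteq> V" using w2 G.E_inV by blast
    ultimately obtain \<phi> where \<phi>: "partial_embedding E W F \<phi> ({w, w2} \<union> h ` ?X)" "\<And>x. x \<in> ?X \<Longrightarrow> \<phi> (h x) = x"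
      using locally_embedsD[OF h, of "{w, w2}"] by blast
    have ww: "(\<phi> w, \<phi> w2) \<in> F" using \<phi>(1) w2 unfolding partial_embedding_def by simp
    have "\<phi> w \<notin> ?X"
    proof
      assume *: "\<phi> w \<in> ?X"
      then have eq: "\<phi> w = \<phi> (h (\<phi> w))" using \<phi>(2) by simp
      have "inj_on \<phi> ({w, w2} \<union> h ` ?X)" using \<phi>(1) by (simp add: partial_embedding_def)
      from inj_onD[OF this, of w "h (\<phi> w)"] have "w = h (\<phi> w)" using eq * by blast
      then show False using w * by blast
    qed
    moreover have "\<phi> w \<in> W" "\<phi> w \<notin> H.isolated" using ww H.E_inV H.isolated_no_edges by blast+
    ultimately have p: "\<phi> w \<in> H.paired" "\<phi> w \<notin> J1" by (auto simp: H.paired_def)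
    then obtain x where x: "x \<in> J1" "\<phi> w = H.mate x" using J1(3) by blast
    have "(x, \<phi> w) \<in> F" using x J1(1) H.mate(1) by auto
    then have "(h x, w) \<in> E" using \<phi> x(1) unfolding partial_embedding_def by (metis UnCI imageI insertI1)
    then show ?thesis using x(1) by blast
  qed
  define a where "a w = (SOME x. x \<in> J1 \<and> (h x, w) \<in> E)" for w
  have a: "a w \<in> J1 \<and> (h (a w), w) \<in> E" if "w \<in> ?O" for w
    unfolding a_def by (rule someI_ex[OF outside[OF that]])
  have "inj_on a ?O"
  proof (rule inj_onI)
    fix w w' assume w: "w \<in> ?O" "w' \<in> ?O" "a w = a w'"
    let ?x = "a w"
    have "card {w, w'} \<le> r" using r by (simp add: card_insert_if)
    moreover have "{w, w'} \<subseteq> V" using w by blast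
    ultimately obtain \<phi> where \<phi>: "partial_embedding E W F \<phi> ({w, w'} \<union> h ` ?X)" "\<And>x. x \<in> ?X \<Longrightarrow> \<phi> (h x) = x"
      using locally_embedsD[OF h, of "{w, w'}"] by blast
    have x: "?x \<in> J1" "(h ?x, w) \<in> E" "(h ?x, w') \<in> E" using a w by metis+
    then have "(?x, \<phi> w) \<in> F" "(?x, \<phi> w') \<in> F"
      using \<phi> unfolding partial_embedding_def by (metis UnCI imageI insertCI)+
    moreover have "?x \<in> H.paired" using x(1) J1(1) by blast
    ultimately have "\<phi> w = \<phi> w'" using H.paired_adj_iff by metis
    then show "w = w'" using \<phi>(1) by (auto simp: partial_embedding_def dest: inj_onD)
  qed
  then have cO: "card ?O \<le> card J1" by (rule card_inj_on_le) (use a fJ1 in auto)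
  have "V - G.isolated \<subseteq> h ` ?X \<union> ?O" by blast
  then have "card (V - G.isolated) \<le> card (h ` ?X \<union> ?O)"
    by (rule card_mono[rotated]) (use G.finite_V H.finite_parts fJ1 in simp)
  also have "\<dots> \<le> card (h ` ?X) + card ?O" by (rule card_Un_le)
  also have "card (h ` ?X) \<le> card ?X" by (rule card_image_le) (use H.finite_parts fJ1 in simp)
  finally have "card (V - G.isolated) \<le> card (core W F) + 2 * card J1" using cX cO by linarith
  moreover have "card (V - G.isolated) = card V - card G.isolated"
    by (rule card_Diff_subset) (use G.finite_parts in \<open>auto simp: G.isolated_def\<close>)
  ultimately show False using J1(4) H.card_split n(1) less by linarith
qed

lemma paired_isomorphism:
  assumes G: "sym_graph V E" and H: "sym_graph W F"
    and eq: "card (sym_graph.paired V E) = card (sym_graph.paired W F)"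
  shows "\<exists>f. isomorphism (sym_graph.paired V E) E (sym_graph.paired W F) F f"
proof -
  interpret G: sym_graph V E by (rule G)
  interpret H: sym_graph W F by (rule H)
  obtain J where J: "J \<subseteq> G.paired" "J \<inter> G.mate ` J = {}" "G.paired = J \<union> G.mate ` J"
    "card G.paired = 2 * card J" "inj_on G.mate J"
    by (rule G.paired_half)
  obtain K where K: "K \<subseteq> H.paired" "K \<inter> H.mate ` K = {}" "H.paired = K \<union> H.mate ` K"
    "card H.paired = 2 * card K" "inj_on H.mate K"
    by (rule H.paired_half)
  have "finite J" "finite K" using J(1) K(1) G.finite_parts(3) H.finite_parts(3) finite_subset by blast+
  moreover have "card J = card K" using J(4) K(4) eq by simp
  ultimately obtain b where b: "bij_betw b J K" using finite_same_card_bij by blast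
  define f where "f v = (if v \<in> J then b v else H.mate (b (G.mate v)))" for v
  have bK: "b v \<in> K" if "v \<in> J" for v using b that by (auto simp: bij_betw_def)
  have fJ: "f v = b v" if "v \<in> J" for v using that by (simp add: f_def)
  have fm: "f (G.mate v) = H.mate (b v)" if "v \<in> J" for v
  proof -
    have "G.mate v \<notin> J" using J(2) that by blast
    then show ?thesis using G.mate(4) that J(1) by (auto simp: f_def)
  qed
  have "bij_betw f J K" using b fJ by (simp cong: bij_betw_cong)
  moreover have "bij_betw f (G.mate ` J) (H.mate ` K)"
  proof (rule bij_betw_imageI)
    show "inj_on f (G.mate ` J)"
    proof (rule inj_onI)
      fix x y assume "x \<in> G.mate ` J" "y \<in> G.mate ` J" "f x = f y"
      then obtain u v where uv: "u \<in> J" "x = G.mate u" "v \<in> J" "y = G.mate v" by blast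
      then have "H.mate (b u) = H.mate (b v)" using \<open>f x = f y\<close> fm by simp
      then have "b u = b v" using K(5) bK uv by (auto dest: inj_onD)
      then show "x = y" using b uv by (auto simp: bij_betw_def dest: inj_onD)
    qed
    have "f ` G.mate ` J = H.mate ` b ` J" using fm by (simp add: image_image)
    then show "f ` G.mate ` J = H.mate ` K" using b by (simp add: bij_betw_def)
  qed
  ultimately have bij: "bij_betw f G.paired H.paired"
    unfolding J(3) K(3) using K(2) by (rule bij_betw_combine)
  have comm: "f (G.mate v) = H.mate (f v)" if "v \<in> G.paired" for v
  proof (cases "v \<in> J")
    case True
    then show ?thesis using fm fJ by simp
  next
    case False
    then obtain u where u: "u \<in> J" "v = G.mate u" using \<open>v \<in> G.paired\<close> J(3) by blast
    then have "G.mate v = u" using J(1) G.mate(4) by blast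
    moreover have "H.mate (H.mate (b u)) = b u" using bK[OF u(1)] K(1) H.mate(4) by blast
    ultimately show ?thesis using u fm fJ by simp
  qed
  have "(u, v) \<in> E \<longleftrightarrow> (f u, f v) \<in> F" if uv: "u \<in> G.paired" "v \<in> G.paired" for u v
  proof -
    have "f u \<in> H.paired" using bij uv by (auto simp: bij_betw_def)
    then have "(f u, f v) \<in> F \<longleftrightarrow> f v = f (G.mate u)" using H.paired_adj_iff comm[OF uv(1)] by simp
    also have "\<dots> \<longleftrightarrow> v = G.mate u"
      using bij uv(2) G.mate(3)[OF uv(1)] by (auto simp: bij_betw_def dest: inj_onD)
    finally show ?thesis using G.paired_adj_iff[OF uv(1)] by simp
  qed
  then show ?thesis using bij unfolding isomorphism_def by blast
qed

text \<open>Equal orders let the same \<open>k\<close> serve in both directions. Cores and isolated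
  vertices are compared both ways, which fixes the number of isolated edges.\<close>

theorem isomorphism_if_same_order:
  assumes G: "bounded_graph V E d" and H: "sym_graph W F" and n: "card V = card W"
    and d: "2 \<le> d" and r: "d\<^sup>2 + d + 3 \<le> r"
    and sim: "simulates k r V E W F" "simulates k r W F V E"
    and k: "\<And>m. 2 * m * d ^ 10 + card V \<le> card V * d ^ 10 \<Longrightarrow> m \<le> k" "2 * card V < 5 * k + 4"
  shows "\<exists>\<Psi>. isomorphism V E W F \<Psi>"
proof -
  interpret G: bounded_graph V E d by (rule G)
  interpret H: sym_graph W F by (rule H)
  have symG: "sym_graph V E" by unfold_locales
  have "d + 2 \<le> r" using r by simp
  then have H': "bounded_graph W F d"
    by (rule bounded_graph_if_simulates[OF G H.finite_V H.E_subset sim(1)])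
  have kW: "m \<le> k" if "2 * m * d ^ 10 + card W \<le> card W * d ^ 10" for m
    using k(1) that n by simp
  have c: "card (core V E) = card (core W F)"
    using core_comparison(1)[OF G H d r sim(1) k(1)] core_comparison(1)[OF H' symG d r sim(2) kW]
    by simp
  then obtain f where f: "isomorphism (core V E) E (core W F) F f"
    using core_comparison(2)[OF H' symG d r sim(2) kW] by blast
  have r3: "3 \<le> r" using r by simp
  have i: "card G.isolated = card H.isolated"
    using isolated_le[OF symG H r3 sim n c k(2)] isolated_le[OF H symG r3 sim(2,1) n[symmetric] c[symmetric]] k(2) n
    by simp
  then obtain g where b: "bij_betw g G.isolated H.isolated"
    using G.finite_parts(2) H.finite_parts(2) finite_same_card_bij by blast
  then have "g v \<in> H.isolated" if "v \<in> G.isolated" for v using that by (auto simp: bij_betw_def)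
  with b have g: "isomorphism G.isolated E H.isolated F g"
    using G.isolated_no_edges H.isolated_no_edges by (simp add: isomorphism_def)
  obtain p where p: "isomorphism G.paired E H.paired F p"
    using paired_isomorphism[OF symG H] G.card_split H.card_split n c i by auto
  obtain q where q: "isomorphism (core V E \<union> G.isolated) E (core W F \<union> H.isolated) F q"
    by (rule isomorphism_union[OF f g G.V_split(2) H.V_split(2)])
      (use G.isolated_no_edges H.isolated_no_edges in blast)+
  have G_no: "(u, v) \<notin> E \<and> (v, u) \<notin> E" if "u \<in> core V E \<union> G.isolated" "v \<in> G.paired" for u v
    using that G.paired_nbrs(1)[of v u] G.E_sym[of u v] G.V_split(3) by blast
  have H_no: "(u, v) \<notin> F \<and> (v, u) \<notin> F" if "u \<in> core W F \<union> H.isolated" "v \<in> H.paired" for u v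
    using that H.paired_nbrs(1)[of v u] H.E_sym[of u v] H.V_split(3) by blast
  obtain \<Psi> where "isomorphism (core V E \<union> G.isolated \<union> G.paired) E (core W F \<union> H.isolated \<union> H.paired) F \<Psi>"
    by (rule isomorphism_union[OF q p G.V_split(3) H.V_split(3) G_no H_no])
  then show ?thesis using G.V_split(1) H.V_split(1) by metis
qed

section \<open>Block formulas\<close>

text \<open>Stated for each word of \<open>nest\<close> instead of through \<open>Max\<close>, so
  that the connectives preserve it immediately.\<close>

definition ranked :: "nat \<Rightarrow> formula \<Rightarrow> bool" where
  "ranked m \<Phi> \<longleftrightarrow> free_vars \<Phi> = {} \<and> (\<forall>w\<in>nest \<Phi>. length w \<le> m \<and> alternations w \<le> 1)"

lemma ranked_rank: "ranked m \<Phi> \<Longrightarrow> quantifier_rank \<Phi> \<le> m"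
  and ranked_alternation: "ranked m \<Phi> \<Longrightarrow> alternation_number \<Phi> \<le> 1"
  and ranked_closed: "ranked m \<Phi> \<Longrightarrow> closed_formula \<Phi>"
  using finite_nest[of \<Phi>] nest_nonempty[of \<Phi>]
  by (auto simp: ranked_def quantifier_rank_def alternation_number_def closed_formula_def)

lemma alternations_map_dual: "alternations (map dual w) = alternations w"
proof (induction w rule: alternations.induct)
  case (1 p q w)
  then show ?case by (cases p; cases q) simp_all
qed simp_all

lemma ranked_Neg: "ranked m \<Phi> \<Longrightarrow> ranked m (Neg \<Phi>)"
  by (auto simp: ranked_def alternations_map_dual)

text \<open>The empty conjunction must be a closed truth, and without truth constants this costs one
  quantifier; hence \<open>1 \<le> m\<close> in \<open>ranked_conjs\<close>.\<close>

fun conjs :: "formula list \<Rightarrow> formula" where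
  "conjs [] = Forall 0 (Equal 0 0)"
| "conjs (\<Phi> # \<Phi>s) = Conj \<Phi> (conjs \<Phi>s)"

lemma sat_conjs: "sat G e (conjs \<Phi>s) \<longleftrightarrow> (\<forall>\<Phi>\<in>set \<Phi>s. sat G e \<Phi>)"
  by (induction \<Phi>s) auto

lemma ranked_Conj: "ranked m \<Phi> \<Longrightarrow> ranked m \<Psi> \<Longrightarrow> ranked m (Conj \<Phi> \<Psi>)"
  by (auto simp: ranked_def)

lemma ranked_conjs: "1 \<le> m \<Longrightarrow> \<forall>\<Phi>\<in>set \<Phi>s. ranked m \<Phi> \<Longrightarrow> ranked m (conjs \<Phi>s)"
proof (induction \<Phi>s)
  case Nil
  then show ?case by (simp add: ranked_def)
qed (simp add: ranked_Conj)

definition literal :: "bool \<Rightarrow> formula \<Rightarrow> formula" where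
  "literal b \<Phi> = (if b then \<Phi> else Neg \<Phi>)"

text \<open>Here the empty case is quantifier-free instead, at the price of the free variable 0,
  which an outer block has to bind.\<close>

fun qf_conjs :: "formula list \<Rightarrow> formula" where
  "qf_conjs [] = Equal 0 0"
| "qf_conjs (\<Phi> # \<Phi>s) = Conj \<Phi> (qf_conjs \<Phi>s)"

fun qf_disjs :: "formula list \<Rightarrow> formula" where
  "qf_disjs [] = Neg (Equal 0 0)"
| "qf_disjs (\<Phi> # \<Phi>s) = Disj \<Phi> (qf_disjs \<Phi>s)"

text \<open>A quantifier-free type of an \<open>m\<close>-tuple: the index pairs that are adjacent and those that are equal.\<close>

type_synonym qf_type = "(nat \<times> nat) set \<times> (nat \<times> nat) set"

definition qf_type :: "nat \<Rightarrow> 'a pair_pre_digraph \<Rightarrow> (nat \<Rightarrow> 'a) \<Rightarrow> qf_type" where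
  "qf_type m G e = ({(i, j). i < m \<and> j < m \<and> (e i, e j) \<in> parcs G}, {(i, j). i < m \<and> j < m \<and> e i = e j})"

definition qf_types :: "nat \<Rightarrow> qf_type set" where
  "qf_types m = Pow ({..<m} \<times> {..<m}) \<times> Pow ({..<m} \<times> {..<m})"

definition type_formula :: "nat \<Rightarrow> qf_type \<Rightarrow> formula" where
  "type_formula m t = qf_conjs [Conj (literal ((i, j) \<in> fst t) (Adj i j)) (literal ((i, j) \<in> snd t) (Equal i j)).
     i \<leftarrow> [0..<m], j \<leftarrow> [0..<m]]"

definition types_formula :: "nat \<Rightarrow> qf_type set \<Rightarrow> formula" where
  "types_formula m T = qf_disjs (map (type_formula m) (SOME ts. set ts = T))"

lemma sat_qf_conjs: "sat G e (qf_conjs \<Phi>s) \<longleftrightarrow> (\<forall>\<Phi>\<in>set \<Phi>s. sat G e \<Phi>)"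
  and sat_qf_disjs: "sat G e (qf_disjs \<Phi>s) \<longleftrightarrow> (\<exists>\<Phi>\<in>set \<Phi>s. sat G e \<Phi>)"
  by (induction \<Phi>s) auto

lemma nest_qf_conjs: "(\<And>\<Phi>. \<Phi> \<in> set \<Phi>s \<Longrightarrow> nest \<Phi> = {[]}) \<Longrightarrow> nest (qf_conjs \<Phi>s) = {[]}"
  and nest_qf_disjs: "(\<And>\<Phi>. \<Phi> \<in> set \<Phi>s \<Longrightarrow> nest \<Phi> = {[]}) \<Longrightarrow> nest (qf_disjs \<Phi>s) = {[]}"
  by (induction \<Phi>s) auto

lemma free_vars_qf_conjs: "free_vars (qf_conjs \<Phi>s) \<subseteq> insert 0 (\<Union>\<Phi>\<in>set \<Phi>s. free_vars \<Phi>)"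
  and free_vars_qf_disjs: "free_vars (qf_disjs \<Phi>s) \<subseteq> insert 0 (\<Union>\<Phi>\<in>set \<Phi>s. free_vars \<Phi>)"
  by (induction \<Phi>s) auto

lemma sat_literal: "sat G e (literal b \<Phi>) \<longleftrightarrow> (sat G e \<Phi> \<longleftrightarrow> b)"
  by (simp add: literal_def)

lemma sat_type_formula:
  assumes "t \<in> qf_types m"
  shows "sat G e (type_formula m t) \<longleftrightarrow> qf_type m G e = t"
proof -
  obtain A Q where t: "t = (A, Q)" by (cases t)
  have "A \<subseteq> {..<m} \<times> {..<m}" "Q \<subseteq> {..<m} \<times> {..<m}" using assms by (auto simp: t qf_types_def)
  moreover have "sat G e (type_formula m t) \<longleftrightarrow>
      (\<forall>i<m. \<forall>j<m. ((e i, e j) \<in> parcs G \<longleftrightarrow> (i, j) \<in> A) \<and> (e i = e j \<longleftrightarrow> (i, j) \<in> Q))"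
    by (auto simp: type_formula_def sat_qf_conjs sat_literal t)
  ultimately show ?thesis by (auto simp: qf_type_def t)
qed

lemma finite_qf_types: "finite (qf_types m)"
  by (simp add: qf_types_def)

lemma qf_type_in: "qf_type m G e \<in> qf_types m"
  by (auto simp: qf_type_def qf_types_def)

lemma set_some_list: "finite T \<Longrightarrow> set (SOME ts. set ts = T) = T"
  by (rule someI_ex) (rule finite_list)

lemma sat_types_formula:
  assumes "T \<subseteq> qf_types m"
  shows "sat G e (types_formula m T) \<longleftrightarrow> qf_type m G e \<in> T"
proof -
  have "finite T" using assms finite_qf_types finite_subset by blast
  then have "sat G e (types_formula m T) \<longleftrightarrow> (\<exists>t\<in>T. sat G e (type_formula m t))"
    by (simp add: types_formula_def sat_qf_disjs set_some_list)
  also have "\<dots> \<longleftrightarrow> (\<exists>t\<in>T. qf_type m G e = t)"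
    by (rule bex_cong[OF refl], rule sat_type_formula) (use assms in auto)
  finally show ?thesis by simp
qed

lemma nest_types_formula: "nest (types_formula m T) = {[]}"
  unfolding types_formula_def type_formula_def
  by (intro nest_qf_disjs) (auto intro!: nest_qf_conjs simp: literal_def split: if_splits)

lemma free_vars_types_formula: "free_vars (types_formula m T) \<subseteq> insert 0 {..<m}"
proof -
  have "free_vars (type_formula m t) \<subseteq> insert 0 {..<m}" for t
    unfolding type_formula_def
    by (rule order_trans[OF free_vars_qf_conjs]) (auto simp: literal_def split: if_splits)
  then show ?thesis
    unfolding types_formula_def by (intro order_trans[OF free_vars_qf_disjs]) auto
qed

section \<open>Quantifier blocks and the formulas of a base\<close>

fun exists_block :: "nat \<Rightarrow> nat \<Rightarrow> formula \<Rightarrow> formula" where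
  "exists_block i 0 \<Phi> = \<Phi>"
| "exists_block i (Suc k) \<Phi> = Exists i (exists_block (Suc i) k \<Phi>)"

fun forall_block :: "nat \<Rightarrow> nat \<Rightarrow> formula \<Rightarrow> formula" where
  "forall_block i 0 \<Phi> = \<Phi>"
| "forall_block i (Suc k) \<Phi> = Forall i (forall_block (Suc i) k \<Phi>)"

definition varies :: "'a set \<Rightarrow> nat \<Rightarrow> nat \<Rightarrow> (nat \<Rightarrow> 'a) \<Rightarrow> (nat \<Rightarrow> 'a) \<Rightarrow> bool" where
  "varies V i k e e' \<longleftrightarrow> (\<forall>j. if j \<in> {i..<i + k} then e' j \<in> V else e' j = e j)"

lemma varies_0: "varies V i 0 e e' \<longleftrightarrow> e' = e"
  by (auto simp: varies_def)

lemma varies_Suc: "varies V i (Suc k) e e' \<longleftrightarrow> (\<exists>v\<in>V. varies V (Suc i) k (e(i := v)) e')"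
proof
  assume v: "varies V i (Suc k) e e'"
  have "e' i \<in> V" using v by (auto simp: varies_def dest: spec[of _ i])
  moreover have "varies V (Suc i) k (e(i := e' i)) e'"
    unfolding varies_def
  proof (intro allI)
    fix j show "if j \<in> {Suc i..<Suc i + k} then e' j \<in> V else e' j = (e(i := e' i)) j"
      using v[unfolded varies_def, THEN spec, of j] by (auto split: if_splits)
  qed
  ultimately show "\<exists>v\<in>V. varies V (Suc i) k (e(i := v)) e'" by blast
next
  assume "\<exists>v\<in>V. varies V (Suc i) k (e(i := v)) e'"
  then obtain v where v: "v \<in> V" "varies V (Suc i) k (e(i := v)) e'" by blast
  show "varies V i (Suc k) e e'"
    unfolding varies_def
  proof (intro allI)
    fix j show "if j \<in> {i..<i + Suc k} then e' j \<in> V else e' j = e j"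
      using v(2)[unfolded varies_def, THEN spec, of j] v(1) by (auto split: if_splits)
  qed
qed

lemma sat_exists_block:
  "sat G e (exists_block i k \<Phi>) \<longleftrightarrow> (\<exists>e'. varies (pverts G) i k e e' \<and> sat G e' \<Phi>)"
  by (induction k arbitrary: i e) (auto simp: varies_0 varies_Suc)

lemma sat_forall_block:
  "sat G e (forall_block i k \<Phi>) \<longleftrightarrow> (\<forall>e'. varies (pverts G) i k e e' \<longrightarrow> sat G e' \<Phi>)"
  by (induction k arbitrary: i e) (auto simp: varies_0 varies_Suc)

lemma nest_exists_block: "nest (exists_block i k \<Phi>) = (\<lambda>w. replicate k QExists @ w) ` nest \<Phi>"
  and nest_forall_block: "nest (forall_block i k \<Phi>) = (\<lambda>w. replicate k QForall @ w) ` nest \<Phi>"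
  by (induction k arbitrary: i) (auto simp: image_image)

lemma free_vars_exists_block: "free_vars (exists_block i k \<Phi>) = free_vars \<Phi> - {i..<i + k}"
  and free_vars_forall_block: "free_vars (forall_block i k \<Phi>) = free_vars \<Phi> - {i..<i + k}"
  by (induction k arbitrary: i) auto

lemma alternations_replicate: "alternations (replicate k q) = 0"
proof (induction k)
  case (Suc k)
  then show ?case by (cases k) auto
qed simp

lemma alternations_blocks: "alternations (replicate k p @ replicate r q) \<le> 1"
proof (induction k)
  case (Suc k)
  show ?case
  proof (cases k)
    case 0
    then show ?thesis using alternations_replicate[of r q] by (cases r) auto
  next
    case (Suc k')
    then show ?thesis using Suc.IH by simp
  qed
qed (simp add: alternations_replicate)

definition block_formula :: "nat \<Rightarrow> nat \<Rightarrow> qf_type set \<Rightarrow> formula" where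
  "block_formula k r T = exists_block 0 k (forall_block k r (types_formula (k + r) T))"

text \<open>Even for \<open>k = 0\<close> the universal block binds variable 0, since
  \<open>1 \<le> r\<close>; this closes the formula also when an empty connective mentions that
  variable.\<close>

lemma ranked_block_formula:
  assumes "1 \<le> r" "k + r \<le> m"
  shows "ranked m (block_formula k r T)"
  using assms free_vars_types_formula[of "k + r" T] alternations_blocks[of k QExists r QForall]
  by (auto simp: ranked_def block_formula_def nest_exists_block nest_forall_block nest_types_formula
      free_vars_exists_block free_vars_forall_block subset_iff)

definition block_formulas :: "nat \<Rightarrow> nat \<Rightarrow> formula set" where
  "block_formulas k r = (\<Union>i\<in>{..k}. block_formula i r ` Pow (qf_types (i + r)))"

lemma finite_block_formulas: "finite (block_formulas k r)"
  by (simp add: block_formulas_def finite_qf_types)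

text \<open>The formula of the overview, with \<open>e\<close> enumerating the base. It depends on
  \<open>G\<close> only through a set of types, so formulas coming from \<open>G\<close> and from
  \<open>H\<close> belong to the same finite family.\<close>

definition over_formula :: "nat \<Rightarrow> 'a pair_pre_digraph \<Rightarrow> nat \<Rightarrow> (nat \<Rightarrow> 'a) \<Rightarrow> formula" where
  "over_formula r G k e = block_formula k r {qf_type (k + r) G e' |e'. varies (pverts G) k r e e'}"

lemma over_formula_in: "k \<le> k' \<Longrightarrow> over_formula r G k e \<in> block_formulas k' r"
  unfolding over_formula_def block_formulas_def using qf_type_in by blast

lemma sat_block_formula:
  assumes "T \<subseteq> qf_types (k + r)"
  shows "sat G e (block_formula k r T) \<longleftrightarrow> (\<exists>e'. varies (pverts G) 0 k e e' \<and>
    (\<forall>e''. varies (pverts G) k r e' e'' \<longrightarrow> qf_type (k + r) G e'' \<in> T))"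
  by (simp add: block_formula_def sat_exists_block sat_forall_block sat_types_formula[OF assms])

lemma sat_over_formula:
  "sat H e' (over_formula r G k e) \<longleftrightarrow> (\<exists>f. varies (pverts H) 0 k e' f \<and>
    (\<forall>f'. varies (pverts H) k r f f' \<longrightarrow> (\<exists>e''. varies (pverts G) k r e e'' \<and> qf_type (k + r) H f' = qf_type (k + r) G e'')))"
  unfolding over_formula_def
proof (subst sat_block_formula)
  show "{qf_type (k + r) G e' |e'. varies (pverts G) k r e e'} \<subseteq> qf_types (k + r)"
    using qf_type_in by blast
qed (simp add: conj_commute)

lemma sat_over_formula_self:
  assumes "\<And>i. i < k \<Longrightarrow> e i \<in> pverts G"
  shows "sat G e (over_formula r G k e)"
  unfolding sat_over_formula
  by (intro exI[of _ e]) (use assms in \<open>auto simp: varies_def\<close>)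

text \<open>A set of at most \<open>r\<close> vertices is listed as an \<open>r\<close>-tuple, and a
  tuple of \<open>G\<close> of the same type over the base gives the embedding. The equalities
  recorded in the type make this map well defined and injective.\<close>

lemma locally_embeds_if_sat:
  assumes fin: "finite (pverts H)" and e: "bij_betw e {..<k} X" and X: "X \<subseteq> pverts G"
    and sat: "sat H e' (over_formula r G k e)"
  obtains h where "locally_embeds r (pverts G) (parcs G) X h (pverts H) (parcs H)"
proof -
  obtain f where f: "varies (pverts H) 0 k e' f"
    and types: "\<And>f'. varies (pverts H) k r f f' \<Longrightarrow>
      \<exists>e''. varies (pverts G) k r e e'' \<and> qf_type (k + r) H f' = qf_type (k + r) G e''"
    using sat unfolding sat_over_formula by blast
  define h where "h x = f (inv_into {..<k} e x)" for x
  have eX: "e ` {..<k} = X" and inje: "inj_on e {..<k}" using e by (auto simp: bij_betw_def)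
  have h: "h (e i) = f i" if "i < k" for i using that inje by (simp add: h_def)
  have fV: "f i \<in> pverts H" if "i < k" for i
    using f[unfolded varies_def, THEN spec, of i] that by simp
  have hX: "h ` X = f ` {..<k}" using h eX by force
  have "\<exists>\<phi>. partial_embedding (parcs H) (pverts G) (parcs G) \<phi> (S \<union> h ` X) \<and> (\<forall>x\<in>X. \<phi> (h x) = x)"
    if S: "S \<subseteq> pverts H" "card S \<le> r" for S
  proof (cases "pverts H = {}")
    case True
    have "k = 0" using fV[of 0] True by auto
    then have "S = {}" "X = {}" using True S eX by auto
    then show ?thesis by (auto simp: partial_embedding_def)
  next
    case False
    then obtain v0 where v0: "v0 \<in> pverts H" by blast
    have "finite S" using S fin finite_subset by blast
    then obtain g where g: "bij_betw g {..<card S} S" using ex_bij_betw_nat_finite by (metis atLeast0LessThan)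
    \<comment> \<open>Sets with fewer than \<open>r\<close> vertices are padded with
      \<open>v0\<close>; this is why an empty \<open>H\<close> is treated separately.\<close>
    define f' where "f' i = (if i < k then f i else if i < k + card S then g (i - k) else if i < k + r then v0 else f i)" for i
    have gS: "g ` {..<card S} = S" using g by (simp add: bij_betw_def)
    have "varies (pverts H) k r f f'"
      unfolding varies_def
    proof (intro allI)
      fix j
      have "g (j - k) \<in> pverts H" if "k \<le> j" "j < k + card S"
      proof -
        have "j - k < card S" using that by linarith
        then show ?thesis using gS S(1) by blast
      qed
      then show "if j \<in> {k..<k + r} then f' j \<in> pverts H else f' j = f j"
        using v0 S(2) by (auto simp: f'_def)
    qed
    then obtain e'' where e'': "varies (pverts G) k r e e''" "qf_type (k + r) H f' = qf_type (k + r) G e''"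
      using types by blast
    have adj: "(f' i, f' j) \<in> parcs H \<longleftrightarrow> (e'' i, e'' j) \<in> parcs G" "f' i = f' j \<longleftrightarrow> e'' i = e'' j"
      if "i < k + r" "j < k + r" for i j
      using e''(2) that by (auto simp: qf_type_def set_eq_iff)
    have e''k: "e'' i = e i" if "i < k" for i using e''(1)[unfolded varies_def, THEN spec, of i] that by simp
    have e''V: "e'' i \<in> pverts G" if "i < k + r" for i
      using e''(1)[unfolded varies_def, THEN spec, of i] that e''k eX X by (auto split: if_splits)
    have f'k: "f' i = f i" if "i < k" for i using that by (simp add: f'_def)
    have reach: "\<exists>i<k + r. u = f' i" if u: "u \<in> S \<union> h ` X" for u
    proof (cases "u \<in> S")
      case True
      then obtain i where i: "i < card S" "u = g i" using gS by blast
      then have "f' (k + i) = u" by (simp add: f'_def)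
      then show ?thesis using i S(2) by (intro exI[of _ "k + i"]) auto
    next
      case False
      then have "u \<in> f ` {..<k}" using u hX by blast
      then obtain i where "i < k" "u = f i" by auto
      then show ?thesis using f'k by (intro exI[of _ i]) auto
    qed
    \<comment> \<open>The choice of index is harmless: indices with equal values under
      \<open>f'\<close> have equal values under \<open>e''\<close>.\<close>
    define \<phi> where "\<phi> u = e'' (SOME i. i < k + r \<and> f' i = u)" for u
    have \<phi>: "\<phi> (f' i) = e'' i" if "i < k + r" for i
    proof -
      have "(SOME j. j < k + r \<and> f' j = f' i) < k + r \<and> f' (SOME j. j < k + r \<and> f' j = f' i) = f' i"
        by (rule someI[of _ i]) (use that in simp)
      then show ?thesis unfolding \<phi>_def using adj(2) that by blast
    qed
    have "partial_embedding (parcs H) (pverts G) (parcs G) \<phi> (S \<union> h ` X)"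
      unfolding partial_embedding_def
    proof (intro conjI ballI subsetI inj_onI)
      fix x assume "x \<in> \<phi> ` (S \<union> h ` X)"
      then obtain u where u: "u \<in> S \<union> h ` X" "x = \<phi> u" by blast
      from reach[OF u(1)] obtain i where "i < k + r" "u = f' i" by blast
      with u(2) show "x \<in> pverts G" using \<phi> e''V by simp
    next
      fix u v assume uv: "u \<in> S \<union> h ` X" "v \<in> S \<union> h ` X" "\<phi> u = \<phi> v"
      from reach[OF uv(1)] obtain i where "i < k + r" "u = f' i" by blast
      moreover from reach[OF uv(2)] obtain j where "j < k + r" "v = f' j" by blast
      ultimately show "u = v" using uv(3) \<phi> adj(2) by simp
    next
      fix u v assume uv: "u \<in> S \<union> h ` X" "v \<in> S \<union> h ` X"
      from reach[OF uv(1)] obtain i where "i < k + r" "u = f' i" by blast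
      moreover from reach[OF uv(2)] obtain j where "j < k + r" "v = f' j" by blast
      ultimately show "(u, v) \<in> parcs H \<longleftrightarrow> (\<phi> u, \<phi> v) \<in> parcs G" using \<phi> adj(1) by simp
    qed
    moreover have "\<phi> (h x) = x" if "x \<in> X" for x
    proof -
      have "x \<in> e ` {..<k}" using that eX by simp
      then obtain i where i: "i < k" "x = e i" by auto
      then have "\<phi> (h x) = \<phi> (f' i)" using h f'k by simp
      then show ?thesis using \<phi>[of i] e''k i by simp
    qed
    ultimately show ?thesis by blast
  qed
  then show thesis using that[of h] fV hX unfolding locally_embeds_def by auto
qed

lemma simulates_if_same_blocks:
  assumes "finite (pverts G)" "finite (pverts H)"
    and "\<And>\<Phi> e. \<Phi> \<in> block_formulas k r \<Longrightarrow> sat G e \<Phi> \<Longrightarrow> \<exists>e'. sat H e' \<Phi>"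
  shows "simulates k r (pverts G) (parcs G) (pverts H) (parcs H)"
  unfolding simulates_def
proof (intro allI impI)
  fix X assume X: "X \<subseteq> pverts G" "card X \<le> k"
  then have "finite X" using assms(1) finite_subset by blast
  then obtain e where e: "bij_betw e {..<card X} X" using ex_bij_betw_nat_finite by (metis atLeast0LessThan)
  then have "sat G e (over_formula r G (card X) e)"
    by (intro sat_over_formula_self) (use X(1) in \<open>auto simp: bij_betw_def\<close>)
  then obtain e' where "sat H e' (over_formula r G (card X) e)"
    using assms(3)[OF over_formula_in[OF X(2)]] by blast
  then show "\<exists>h. locally_embeds r (pverts G) (parcs G) X h (pverts H) (parcs H)"
    using locally_embeds_if_sat[OF assms(2) e X(1)] by metis
qed

text \<open>Only finitely many block formulas exist for given \<open>k\<close> and \<open>r\<close>, so one formula can record the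
  truth values in \<open>G\<close> of all of them.\<close>

definition theory_formula :: "nat \<Rightarrow> nat \<Rightarrow> 'a pair_pre_digraph \<Rightarrow> formula" where
  "theory_formula k r G = conjs (map (\<lambda>\<Phi>. literal (holds G \<Phi>) \<Phi>) (SOME \<Phi>s. set \<Phi>s = block_formulas k r))"

lemma ranked_block_formulas: "1 \<le> r \<Longrightarrow> \<Phi> \<in> block_formulas k r \<Longrightarrow> ranked (k + r) \<Phi>"
  unfolding block_formulas_def using ranked_block_formula by auto

lemma ranked_theory_formula: "1 \<le> r \<Longrightarrow> ranked (k + r) (theory_formula k r G)"
proof -
  assume r: "1 \<le> r"
  have "ranked (k + r) (literal (holds G \<Phi>) \<Phi>)" if "\<Phi> \<in> block_formulas k r" for \<Phi>
    using ranked_block_formulas[OF r that] ranked_Neg by (simp add: literal_def)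
  then show ?thesis
    unfolding theory_formula_def using r
    by (intro ranked_conjs) (simp_all add: set_some_list finite_block_formulas)
qed

lemma sat_theory_formula:
  assumes "1 \<le> r"
  shows "sat H e (theory_formula k r G) \<longleftrightarrow> (\<forall>\<Phi>\<in>block_formulas k r. holds H \<Phi> \<longleftrightarrow> holds G \<Phi>)"
proof -
  have "sat H e \<Phi> \<longleftrightarrow> holds H \<Phi>" if "\<Phi> \<in> block_formulas k r" for \<Phi>
    using holds_iff_sat[OF ranked_closed[OF ranked_block_formulas[OF assms that]], of H e] by simp
  then show ?thesis
    by (simp add: theory_formula_def sat_conjs set_some_list finite_block_formulas sat_literal)
qed

text \<open>The second direction uses the negated conjuncts: a block formula read off from
  \<open>H\<close> is true in \<open>H\<close>, and if it failed in \<open>G\<close> its negation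
  would have been recorded.\<close>

lemma theory_formula_simulates:
  assumes "1 \<le> r" "finite (pverts G)" "finite (pverts H)" "sat H e (theory_formula k r G)"
  shows "simulates k r (pverts G) (parcs G) (pverts H) (parcs H)"
    "simulates k r (pverts H) (parcs H) (pverts G) (parcs G)"
proof -
  have eq: "sat H e \<Phi> \<longleftrightarrow> sat G e' \<Phi>" if "\<Phi> \<in> block_formulas k r" for \<Phi> e e'
  proof -
    note closed = ranked_closed[OF ranked_block_formulas[OF assms(1) that]]
    have "holds H \<Phi> \<longleftrightarrow> holds G \<Phi>" using assms(4) that sat_theory_formula[OF assms(1)] by blast
    then show ?thesis using holds_iff_sat[OF closed, of H e] holds_iff_sat[OF closed, of G e'] by simp
  qed
  show "simulates k r (pverts G) (parcs G) (pverts H) (parcs H)"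
    using simulates_if_same_blocks[OF assms(2,3)] eq by blast
  show "simulates k r (pverts H) (parcs H) (pverts G) (parcs G)"
    using simulates_if_same_blocks[OF assms(3,2)] eq by blast
qed

text \<open>Its prefix starts with a universal quantifier, unlike that of a block formula. A
  conjunction keeps the words of its parts separate, so still only one alternation occurs.\<close>

definition core_formula :: formula where
  "core_formula = Forall 0 (Exists 1 (Exists 2 (Conj (Adj 0 1)
     (Conj (Neg (Equal 2 0)) (Conj (Neg (Equal 2 1)) (Disj (Adj 0 2) (Adj 1 2)))))))"

lemma ranked_core_formula: "3 \<le> m \<Longrightarrow> ranked m core_formula"
  by (auto simp: ranked_def core_formula_def)

lemma sat_core_formula:
  assumes "parcs G \<subseteq> pverts G \<times> pverts G"
  shows "sat G e core_formula \<longleftrightarrow> core (pverts G) (parcs G) = pverts G"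
  using assms by (auto simp: core_formula_def core_def) blast+

section \<open>The bound\<close>

lemma degree_eq_card: "degree G v = card (parcs G `` {v})"
proof -
  have "bij_betw snd (out_arcs (with_proj G) v) (parcs G `` {v})"
    by (rule bij_betwI[where g = "\<lambda>u. (v, u)"]) (auto simp: out_arcs_def)
  then show ?thesis by (simp add: out_degree_def bij_betw_same_card)
qed

lemma sym_graph_if_pair_graph:
  assumes "pair_graph G"
  shows "sym_graph (pverts G) (parcs G)"
proof -
  interpret pair_graph G by (rule assms)
  show ?thesis
  proof
    show "finite (pverts G)" by (rule pair_finite_verts)
    show "parcs G \<subseteq> pverts G \<times> pverts G" using wellformed' by auto
    show "(v, u) \<in> parcs G" if "(u, v) \<in> parcs G" for u v
      using that pair_sym_arcs by (auto simp: symmetric_def elim: symE)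
    show "(v, v) \<notin> parcs G" for v using pair_no_loops by force
  qed
qed

lemma bounded_graph_if_max_degree:
  assumes "pair_graph G" "max_degree G = d"
  shows "bounded_graph (pverts G) (parcs G) d"
proof -
  interpret sym_graph "pverts G" "parcs G" by (rule sym_graph_if_pair_graph[OF assms(1)])
  show ?thesis
  proof
    fix v
    show "card (parcs G `` {v}) \<le> d"
    proof (cases "v \<in> pverts G")
      case True
      then have "degree G v \<le> max_degree G" using finite_V by (simp add: max_degree_def)
      then show ?thesis using assms(2) degree_eq_card[of G] by simp
    next
      case False
      then have "parcs G `` {v} = {}" using E_inV by blast
      then show ?thesis by simp
    qed
  qed
qed

lemma three_vertices_if_max_degree:
  assumes "pair_graph G" "2 \<le> max_degree G"
  shows "3 \<le> card (pverts G)"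
proof -
  interpret sym_graph "pverts G" "parcs G" by (rule sym_graph_if_pair_graph[OF assms(1)])
  have "max_degree G \<in> insert 0 (degree G ` pverts G)"
    unfolding max_degree_def by (rule Max_in) (use finite_V in auto)
  then obtain v where v: "v \<in> pverts G" "2 \<le> card (parcs G `` {v})"
    using assms(2) degree_eq_card[of G] by auto
  have "finite (parcs G `` {v})" "insert v (parcs G `` {v}) \<subseteq> pverts G" "v \<notin> parcs G `` {v}"
    using E_inV E_irrefl v(1) finite_subset[OF E_subset] finite_V by auto
  then have "card (parcs G `` {v}) + 1 \<le> card (pverts G)"
    using card_mono[OF finite_V, of "insert v (parcs G `` {v})"] by simp
  then show ?thesis using v(2) by linarith
qed

text \<open>A non-isolated vertex outside the core and its mate reach each other and nothing else,
  so they form an isolated edge.\<close>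

lemma core_eq_if_no_isolated:
  assumes G: "pair_graph G" and iso: "\<not> has_isolated_vertex G" "\<not> has_isolated_edge G"
  shows "core (pverts G) (parcs G) = pverts G"
proof (rule ccontr)
  interpret P: pair_graph G by (rule G)
  interpret sym_graph "pverts G" "parcs G" by (rule sym_graph_if_pair_graph[OF G])
  assume "\<not> ?thesis"
  then obtain v where v: "v \<in> pverts G" "v \<notin> core (pverts G) (parcs G)" using core_subset by blast
  have "degree G v \<noteq> 0" using iso(1) v(1) by (auto simp: has_isolated_vertex_def)
  then have "v \<notin> isolated" using degree_eq_card[of G v] by (auto simp: isolated_def)
  then have p: "v \<in> paired" using v by (auto simp: paired_def)
  let ?u = "mate v"
  have out: "b \<in> {v, ?u}" if "a \<in> {v, ?u}" "(a, b) \<in> parcs G" for a b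
    using that paired_adj_iff[OF p] paired_adj_iff[OF mate(3)[OF p]] mate(4)[OF p] by auto
  have stay: "b \<in> {v, ?u}" if "a \<rightarrow>\<^sup>*\<^bsub>with_proj G\<^esub> b" "a \<in> {v, ?u}" for a b
    using that(1)
  proof (induction rule: P.reachable_induct)
    case base
    then show ?case using that(2) by simp
  next
    case (step x y)
    then show ?case using out by simp
  qed
  have "v \<rightarrow>\<^bsub>with_proj G\<^esub> ?u" "?u \<rightarrow>\<^bsub>with_proj G\<^esub> v" using mate(1)[OF p] E_sym by simp_all
  then have "{v, ?u} \<in> P.sccs_verts"
    unfolding P.sccs_verts_def using stay v(1) E_inV[OF mate(1)[OF p]]
    by (auto intro: P.reachable_adjI P.reachable_refl)
  then show False using iso(2) mate(1)[OF p] by (auto simp: has_isolated_edge_def)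
qed

lemma isomorphic_if_isomorphism:
  assumes "pair_wf_digraph G" "pair_wf_digraph H" "isomorphism (pverts G) (parcs G) (pverts H) (parcs H) f"
  shows "isomorphic G H"
  unfolding isomorphic_iff[OF assms(1,2)] using assms(3) by (auto simp: isomorphism_def)

lemma D1_le_if_defines: "ranked m \<Phi> \<Longrightarrow> defines_graph \<Phi> G \<Longrightarrow> D1 G \<le> enat m"
  unfolding D1_def using ranked_closed ranked_alternation ranked_rank
  by (intro INF_lower2[of \<Phi>]) auto

lemma D1_bar_le_if_identifies: "ranked m \<Phi> \<Longrightarrow> identifies_graph \<Phi> G \<Longrightarrow> D1_bar G \<le> enat m"
  unfolding D1_bar_def using ranked_closed ranked_alternation ranked_rank
  by (intro INF_lower2[of \<Phi>]) auto

section \<open>The defining and identifying formulas\<close>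

locale max_degree_graph =
  fixes G :: "'a pair_pre_digraph" and d r k :: nat
  assumes d: "2 \<le> d" and G: "pair_graph G" and max_deg: "max_degree G = d" and r: "d\<^sup>2 + d + 3 \<le> r"
    and k: "\<And>m. 2 * m * d ^ 10 + card (pverts G) \<le> card (pverts G) * d ^ 10 \<Longrightarrow> m \<le> k"
begin

sublocale bounded_graph "pverts G" "parcs G" d
  by (rule bounded_graph_if_max_degree[OF G max_deg])

sublocale P: pair_graph G by (rule G)

lemma one_le_r: "1 \<le> r" and three_le_r: "3 \<le> k + r"
  using r by auto

lemma sat_theory_self: "sat G e (theory_formula k r G)"
  by (simp add: sat_theory_formula[OF one_le_r])

text \<open>Nothing is known of \<open>H\<close> beyond finiteness: \<open>theory_formula\<close>
  makes it a graph of degree at most \<open>d\<close>, and \<open>core_formula\<close> excludes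
  isolated vertices and edges.\<close>

lemma D1_le:
  assumes core: "core (pverts G) (parcs G) = pverts G"
  shows "D1 G \<le> enat (k + r)"
proof (rule D1_le_if_defines)
  let ?\<Phi> = "Conj core_formula (theory_formula k r G)"
  show rk: "ranked (k + r) ?\<Phi>"
    by (rule ranked_Conj[OF ranked_core_formula[OF three_le_r] ranked_theory_formula[OF one_le_r]])
  show "defines_graph ?\<Phi> G"
    unfolding defines_graph_def distinguishes_def
  proof (intro allI impI conjI notI; elim conjE)
    show "holds G ?\<Phi>"
      using core sat_theory_self by (simp add: holds_def sat_core_formula[OF E_subset])
    fix H :: "nat pair_pre_digraph"
    assume H: "pair_fin_digraph H" and ni: "\<not> isomorphic G H" and h: "holds H ?\<Phi>"
    interpret H: pair_fin_digraph H by (rule H)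
    have sub: "parcs H \<subseteq> pverts H \<times> pverts H" using H.wellformed' by auto
    have "sat H e core_formula" and th: "sat H e (theory_formula k r G)" for e
      using h by (simp_all add: holds_def)
    then have coreH: "core (pverts H) (parcs H) = pverts H" using sat_core_formula[OF sub] by blast
    note sim = theory_formula_simulates[OF one_le_r finite_V H.pair_finite_verts th]
    obtain \<Psi> where "isomorphism (pverts G) (parcs G) (pverts H) (parcs H) \<Psi>"
      using isomorphism_if_all_core[OF bounded_graph_axioms H.pair_finite_verts sub core coreH d r sim k] by blast
    then have "isomorphic G H"
      by (rule isomorphic_if_isomorphism[OF P.pair_wf_digraph_axioms H.pair_wf_digraph_axioms])
    with ni show False by blast
  qed
qed

lemma D1_bar_le:
  assumes k': "2 * card (pverts G) < 5 * k + 4"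
  shows "D1_bar G \<le> enat (k + r)"
proof (rule D1_bar_le_if_identifies)
  let ?\<Phi> = "theory_formula k r G"
  show rk: "ranked (k + r) ?\<Phi>" by (rule ranked_theory_formula[OF one_le_r])
  show "identifies_graph ?\<Phi> G"
    unfolding identifies_graph_def distinguishes_def
  proof (intro allI impI conjI notI; elim conjE)
    show "holds G ?\<Phi>" using sat_theory_self by (simp add: holds_def)
    fix H :: "nat pair_pre_digraph"
    assume H: "pair_graph H" and n: "card (pverts H) = card (pverts G)" and ni: "\<not> isomorphic G H"
      and h: "holds H ?\<Phi>"
    interpret H: pair_graph H by (rule H)
    have th: "sat H e ?\<Phi>" for e using h by (simp add: holds_def)
    note sim = theory_formula_simulates[OF one_le_r finite_V H.pair_finite_verts th]
    obtain \<Psi> where "isomorphism (pverts G) (parcs G) (pverts H) (parcs H) \<Psi>"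
      using isomorphism_if_same_order[OF bounded_graph_axioms sym_graph_if_pair_graph[OF H] n[symmetric] d r sim k k'] by blast
    then have "isomorphic G H"
      by (rule isomorphic_if_isomorphism[OF P.pair_wf_digraph_axioms H.pair_wf_digraph_axioms])
    with ni show False by blast
  qed
qed

end

lemma bound_const_eq: "bound_const d = 1 / 2 - 1 / (10 * real d ^ (2 * d + 5))"
proof -
  have "- 2 * int d - 5 = - int (2 * d + 5)" by simp
  then have "real d powi (- 2 * int d - 5) = inverse (real d ^ (2 * d + 5))"
    by (metis power_int_minus power_int_of_nat)
  then show ?thesis by (simp add: bound_const_def field_simps)
qed

text \<open>For \<open>3 \<le> d\<close> the exponent \<open>2 * d + 5\<close> is at least 11. For
  \<open>d = 2\<close> it is only 9, and the factor 5 is essential: 1024 against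
  \<open>5 * 512\<close>.\<close>

lemma power_10_le: "2 \<le> d \<Longrightarrow> real d ^ 10 \<le> 5 * real d ^ (2 * d + 5)"
proof (cases "d = 2")
  case False
  assume "2 \<le> d"
  with False have "3 \<le> d" by simp
  then have "real d ^ 10 \<le> real d ^ (2 * d + 5)" by (intro power_increasing) auto
  also have "\<dots> \<le> 5 * real d ^ (2 * d + 5)" by simp
  finally show ?thesis .
qed simp

theorem theorem6p2:
  fixes G :: "'a pair_pre_digraph" and d n :: nat
  assumes "2 \<le> d"
    and "pair_graph G"
    and "card (pverts G) = n"
    and "max_degree G = d"
  shows "(\<not> has_isolated_vertex G \<and> \<not> has_isolated_edge G \<longrightarrow>
           ereal_of_enat (D1 G) \<le> ereal (bound_const d * real n + real d ^ 2 + real d + 7/2)) \<and>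
         ereal_of_enat (D1_bar G) \<le> ereal (bound_const d * real n + real d ^ 2 + real d + 7/2)"
proof -
  \<comment> \<open>The base size is an integer, so the floor loses nothing.\<close>
  define k where "k = nat \<lfloor>bound_const d * real n\<rfloor>"
  define r where "r = d\<^sup>2 + d + 3"
  \<comment> \<open>Here \<open>512 = 2 ^ 9\<close> is the value at \<open>d = 2\<close>, so
    \<open>bound_const d\<close> is at least \<open>1/2 - 1/5120\<close>.\<close>
  have d5: "512 \<le> real d ^ (2 * d + 5)"
  proof -
    have "(2::real) ^ 9 \<le> 2 ^ (2 * d + 5)" using assms(1) by (intro power_increasing) auto
    also have "\<dots> \<le> real d ^ (2 * d + 5)" using assms(1) by (intro power_mono) auto
    finally show ?thesis by simp
  qed
  have pos: "0 < real d ^ 10" "0 < real d ^ (2 * d + 5)" using assms(1) by simp_all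
  have c: "1 / 2 - 1 / 5120 \<le> bound_const d"
    unfolding bound_const_eq using d5 pos by (simp add: field_simps)
  then have cn: "0 \<le> bound_const d * real n" by simp
  have k_le: "real k \<le> bound_const d * real n" and k_gt: "bound_const d * real n - 1 < real k"
    using cn unfolding k_def by linarith+
  have base: "m \<le> k" if m: "2 * m * d ^ 10 + n \<le> n * d ^ 10" for m
  proof -
    have "real (2 * m * d ^ 10 + n) \<le> real (n * d ^ 10)" using m of_nat_le_iff by blast
    then have "2 * real m * real d ^ 10 + real n \<le> real n * real d ^ 10" by simp
    then have "real m \<le> real n * (1 / 2 - 1 / (2 * real d ^ 10))" using pos by (simp add: field_simps)
    also have "\<dots> \<le> real n * bound_const d"
      unfolding bound_const_eq using power_10_le[OF assms(1)] pos
      by (intro mult_left_mono diff_left_mono) (auto simp: field_simps)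
    finally have "real m \<le> bound_const d * real n" by (simp add: mult.commute)
    then have "int m \<le> \<lfloor>bound_const d * real n\<rfloor>" by (simp add: le_floor_iff)
    then show ?thesis unfolding k_def by linarith
  qed
  interpret max_degree_graph G d r k
    by (rule max_degree_graph.intro) (use assms base in \<open>simp_all add: r_def\<close>)
  have "3 \<le> n" using three_vertices_if_max_degree[OF assms(2)] assms(1,3,4) by simp
  \<comment> \<open>Since \<open>k\<close> exceeds \<open>bound_const d * n - 1\<close>, it is
    enough that \<open>(5/2 - 5/5120) * n - 1 \<ge> 2 * n\<close>. This holds from
    \<open>n = 3\<close> on but not for \<open>n = 2\<close>.\<close>
  have "2 * real n < 5 * real k + 4"
  proof -
    have "(1 / 2 - 1 / 5120) * real n \<le> bound_const d * real n" using c by (intro mult_right_mono) auto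
    moreover have "3 \<le> real n" using \<open>3 \<le> n\<close> by simp
    ultimately show ?thesis using k_gt by (simp only: left_diff_distrib)
  qed
  then have k': "2 * card (pverts G) < 5 * k + 4" using assms(3) by linarith
  have le: "ereal_of_enat x \<le> ereal (bound_const d * real n + real d ^ 2 + real d + 7/2)"
    if "x \<le> enat (k + r)" for x
  proof -
    have "ereal_of_enat x \<le> ereal_of_enat (enat (k + r))" using that by (simp only: ereal_of_enat_le_iff)
    also have "\<dots> = ereal (real (k + r))" by simp
    also have "\<dots> \<le> ereal (bound_const d * real n + real d ^ 2 + real d + 7/2)"
      using k_le by (simp add: r_def)
    finally show ?thesis .
  qed
  show ?thesis using le D1_le core_eq_if_no_isolated[OF assms(2)] D1_bar_le[OF k'] by blast
qed

end
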